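(* Let $(\mathcal{A},\alpha,\gamma)$ be a graded $C^*$-dynamical system, let $\beta\in\mathbb{R}\setminus\{0\}$, and let $\boldsymbol{\mathcal{A}}=\mathcal{A}\rtimes_\gamma\mathbb{Z}_2$ be its $\mathbb{Z}_2$-crossed product with the extended dynamics $\boldsymbol{\alpha}$. There is a bijection $$\mathcal{S}_\beta(\boldsymbol{\mathcal{A}},\boldsymbol{\alpha})\simeq\{(\omega,\rho)\;|\;\omega\in\mathcal{S}_\beta(\mathcal{A},\alpha,\gamma),\ \rho\in\mathcal{F}_\beta(\mathcal{A},\alpha,\gamma,\omega)\}$$ carrying a KMS state $\boldsymbol{\omega}\in\mathcal{S}_\beta(\boldsymbol{\mathcal{A}},\boldsymbol{\alpha})$ into the pair $(\omega,\rho)$ given by $\omega=\boldsymbol{\omega}|_{\mathcal{A}\oplus 0}$, $\rho=\boldsymbol{\omega}|_{0\oplus\mathcal{A}}$ (that is, $\omega(a)=\boldsymbol{\omega}(a,0)$ and $\rho(b)=\boldsymbol{\omega}(0,b)$), and a pair $(\omega,\rho)$ into the KMS state $$\boldsymbol{\omega}(a,b)=\omega(a)+\rho(b),\qquad a,b\in\mathcal{A}.$$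
   Context: All $C^*$-algebras are unital. A graded $C^*$-dynamical system $(\mathcal{A},\alpha,\gamma)$ consists of a $C^*$-algebra $\mathcal{A}$, a strongly continuous action $\alpha$ of $\mathbb{R}$ on $\mathcal{A}$ by automorphisms, and an automorphism $\gamma$ of $\mathcal{A}$ with $\gamma^2=\mathrm{id}$ and $\alpha_t\circ\gamma=\gamma\circ\alpha_t$ for all $t\in\mathbb{R}$. $\mathcal{A}_\alpha\subset\mathcal{A}$ is the norm dense ${}^*$-subalgebra of entire analytic elements for $\alpha$. A state $\omega$ on $\mathcal{A}$ is an $(\alpha,\beta)$-KMS state if $\omega(a\alpha_{i\beta}(b))=\omega(ba)$ for all $a,b\in\mathcal{A}_\alpha$. $\mathcal{S}_\beta(\mathcal{A},\alpha)$ is the set of all $(\alpha,\beta)$-KMS states and $\mathcal{S}_\beta(\mathcal{A},\alpha,\gamma)$ the subset of $\gamma$-invariant ones. A linear functional $\rho$ on $\mathcal{A}$ is a $\gamma$-twisted $(\alpha,\beta)$-KMS functional if $\rho(a\alpha_{i\beta}(b))=\rho(b\gamma(a))$ for all $a,b\in\mathcal{A}_\alpha$; $\mathcal{F}_\beta(\mathcal{A},\alpha,\gamma)$ is the set of these. For a state $\omega$, $\mathcal{F}_\beta(\mathcal{A},\alpha,\gamma,\omega)$ is the set of $\rho\in\mathcal{F}_\beta(\mathcal{A},\alpha,\gamma)$ that are hermitian, i.e. $\overline{\rho(a^* )}=\rho(a)$ for all $a\in\mathcal{A}$, and dominated by $\omega$, i.e. $|\rho(a^*b)|^2\le\omega(a^*a)\,\omega(b^*b)$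 for all $a,b\in\mathcal{A}$. The crossed product $\boldsymbol{\mathcal{A}}=\mathcal{A}\rtimes_\gamma\mathbb{Z}_2$ is the linear space $\mathcal{A}\oplus\mathcal{A}$ with product $(a,b)(a',b')=(aa'+b\gamma(b'),\,ab'+b\gamma(a'))$, involution $(a,b)^*=(a^*,\gamma(b^* ))$, unit $(1,0)$, and norm $\|(a,b)\|$ equal to the norm of the matrix $\begin{pmatrix}a&b\\ \gamma(b)&\gamma(a)\end{pmatrix}\in M_2(\mathcal{A})$. The dynamics extends to $\boldsymbol{\mathcal{A}}$ by $\boldsymbol{\alpha}_t(a,b)=(\alpha_t(a),\alpha_t(b))$. *)

theory Defs
  imports "HOL-Analysis.Analysis" "HOL-Library.Complex_Order"
begin

section \<open>Unital \<open>C\<^sup>*\<close>-algebras\<close>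

class complex_vector = real_vector +
  fixes scaleC :: "complex \<Rightarrow> 'a \<Rightarrow> 'a"  (infixr "*\<^sub>C" 75)
  assumes scaleC_add_right: "c *\<^sub>C (x + y) = c *\<^sub>C x + c *\<^sub>C y"
    and scaleC_add_left: "(c + d) *\<^sub>C x = c *\<^sub>C x + d *\<^sub>C x"
    and scaleC_scaleC: "c *\<^sub>C d *\<^sub>C x = (c * d) *\<^sub>C x"
    and scaleC_one: "1 *\<^sub>C x = x"
    and scaleR_scaleC: "r *\<^sub>R x = complex_of_real r *\<^sub>C x"

instantiation prod :: (complex_vector, complex_vector) complex_vector
begin

definition scaleC_prod_def: "c *\<^sub>C p = (c *\<^sub>C fst p, c *\<^sub>C snd p)"

instance
  by standard
    (simp_all add: scaleC_prod_def prod_eq_iff scaleC_add_right scaleC_add_left scaleC_scaleC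
      scaleC_one scaleR_scaleC)

end

abbreviation clinear :: "('a::complex_vector \<Rightarrow> 'b::complex_vector) \<Rightarrow> bool" where
  "clinear \<equiv> Vector_Spaces.linear scaleC scaleC"

abbreviation clinear_functional :: "('a::complex_vector \<Rightarrow> complex) \<Rightarrow> bool" where
  "clinear_functional \<equiv> Vector_Spaces.linear scaleC (*)"

class cstar_algebra = complex_vector + real_normed_algebra_1 + banach +
  fixes star :: "'a \<Rightarrow> 'a"
  assumes mult_scaleC_left: "(c *\<^sub>C x) * y = c *\<^sub>C (x * y)"
    and mult_scaleC_right: "x * (c *\<^sub>C y) = c *\<^sub>C (x * y)"
    and norm_scaleC: "norm (c *\<^sub>C x) = cmod c * norm x"
    and star_add: "star (x + y) = star x + star y"
    and star_scaleC: "star (c *\<^sub>C x) = cnj c *\<^sub>C star x"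
    and star_mult: "star (x * y) = star y * star x"
    and star_star: "star (star x) = x"
    and cstar_identity: "norm (star x * x) = (norm x)\<^sup>2"

definition star_automorphism :: "('a::cstar_algebra \<Rightarrow> 'a) \<Rightarrow> bool" where
  "star_automorphism \<phi> \<longleftrightarrow>
     clinear \<phi> \<and> bij \<phi> \<and> (\<forall>x y. \<phi> (x * y) = \<phi> x * \<phi> y) \<and> (\<forall>x. \<phi> (star x) = star (\<phi> x))"

locale graded_cstar_dynamical_system =
  fixes \<alpha> :: "real \<Rightarrow> 'a::cstar_algebra \<Rightarrow> 'a" and \<gamma> :: "'a \<Rightarrow> 'a"
  assumes automorphism_dynamics: "star_automorphism (\<alpha> t)"
    and dynamics_zero: "\<alpha> 0 = id"
    and dynamics_add: "\<alpha> (s + t) = \<alpha> s \<circ> \<alpha> t"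
    and strongly_continuous: "continuous_on UNIV (\<lambda>t. \<alpha> t a)"
    and automorphism_grading: "star_automorphism \<gamma>"
    and grading_involutive: "\<gamma> \<circ> \<gamma> = id"
    and dynamics_grading: "\<alpha> t \<circ> \<gamma> = \<gamma> \<circ> \<alpha> t"


section \<open>\<open>C\<^sup>*\<close>-structures, states and KMS states\<close>

text \<open>
  The multiplication and the norm of the crossed product depend on the automorphism \<open>\<gamma>\<close>, so
  they cannot be given by a class instance on \<^typ>\<open>'a \<times> 'a\<close>. The notions that are needed both for
  the algebra itself and for its crossed product therefore take the unital normed
  \<open>*\<close>-algebra structure on a complex vector space as an explicit argument. In particular
  the class norm of \<^typ>\<open>'a \<times> 'a\<close> plays no role.
\<close>

record 'a cstar_structure =
  Mult :: "'a \<Rightarrow> 'a \<Rightarrow> 'a"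
  Unit :: 'a
  Star :: "'a \<Rightarrow> 'a"
  Norm :: "'a \<Rightarrow> real"

definition algebra_structure :: "'a::cstar_algebra cstar_structure" where
  "algebra_structure = \<lparr>Mult = (*), Unit = 1, Star = star, Norm = norm\<rparr>"

text \<open>
  The order on \<^typ>\<open>complex\<close> is that of \<^theory>\<open>HOL-Library.Complex_Order\<close>: \<open>0 \<le> z\<close> says that
  \<open>z\<close> is real and nonnegative. Boundedness of positive functionals is automatic.
\<close>

definition states :: "'a::complex_vector cstar_structure \<Rightarrow> ('a \<Rightarrow> complex) set" where
  "states A =
     {\<omega>. clinear_functional \<omega> \<and> (\<forall>a. 0 \<le> \<omega> (Mult A (Star A a) a)) \<and> \<omega> (Unit A) = 1}"

definition entire_function ::
    "'a::complex_vector cstar_structure \<Rightarrow> (complex \<Rightarrow> 'a) \<Rightarrow> bool" where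
  "entire_function A f \<longleftrightarrow>
     (\<forall>z. \<exists>d. ((\<lambda>h. Norm A (inverse h *\<^sub>C (f (z + h) - f z) - d)) \<longlongrightarrow> 0) (at 0))"

definition entire_extension ::
    "'a::complex_vector cstar_structure \<Rightarrow> (real \<Rightarrow> 'a \<Rightarrow> 'a) \<Rightarrow> 'a \<Rightarrow> (complex \<Rightarrow> 'a) \<Rightarrow> bool" where
  "entire_extension A \<alpha> a f \<longleftrightarrow>
     entire_function A f \<and> (\<forall>t. f (complex_of_real t) = \<alpha> t a)"

definition analytic_elements ::
    "'a::complex_vector cstar_structure \<Rightarrow> (real \<Rightarrow> 'a \<Rightarrow> 'a) \<Rightarrow> 'a set" where
  "analytic_elements A \<alpha> = {a. \<exists>f. entire_extension A \<alpha> a f}"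

text \<open>The value \<open>\<alpha>\<^sub>z(a)\<close> for analytic \<open>a\<close>; the extension is unique by the identity theorem.\<close>

definition complex_dynamics ::
    "'a::complex_vector cstar_structure \<Rightarrow> (real \<Rightarrow> 'a \<Rightarrow> 'a) \<Rightarrow> complex \<Rightarrow> 'a \<Rightarrow> 'a" where
  "complex_dynamics A \<alpha> z a = (THE f. entire_extension A \<alpha> a f) z"

definition KMS_states ::
    "'a::complex_vector cstar_structure \<Rightarrow> (real \<Rightarrow> 'a \<Rightarrow> 'a) \<Rightarrow> real \<Rightarrow> ('a \<Rightarrow> complex) set" where
  "KMS_states A \<alpha> \<beta> =
     {\<omega> \<in> states A. \<forall>a \<in> analytic_elements A \<alpha>. \<forall>b \<in> analytic_elements A \<alpha>.
        \<omega> (Mult A a (complex_dynamics A \<alpha> (\<i> * complex_of_real \<beta>) b)) = \<omega> (Mult A b a)}"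

definition invariant_KMS_states ::
    "(real \<Rightarrow> 'a::cstar_algebra \<Rightarrow> 'a) \<Rightarrow> ('a \<Rightarrow> 'a) \<Rightarrow> real \<Rightarrow> ('a \<Rightarrow> complex) set" where
  "invariant_KMS_states \<alpha> \<gamma> \<beta> = {\<omega> \<in> KMS_states algebra_structure \<alpha> \<beta>. \<forall>a. \<omega> (\<gamma> a) = \<omega> a}"

definition twisted_KMS_functionals ::
    "(real \<Rightarrow> 'a::cstar_algebra \<Rightarrow> 'a) \<Rightarrow> ('a \<Rightarrow> 'a) \<Rightarrow> real \<Rightarrow> ('a \<Rightarrow> complex) set" where
  "twisted_KMS_functionals \<alpha> \<gamma> \<beta> =
     {\<rho>. clinear_functional \<rho> \<and>
        (\<forall>a \<in> analytic_elements algebra_structure \<alpha>. \<forall>b \<in> analytic_elements algebra_structure \<alpha>.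
          \<rho> (a * complex_dynamics algebra_structure \<alpha> (\<i> * complex_of_real \<beta>) b) = \<rho> (b * \<gamma> a))}"

definition hermitian_functional :: "('a::cstar_algebra \<Rightarrow> complex) \<Rightarrow> bool" where
  "hermitian_functional \<rho> \<longleftrightarrow> (\<forall>a. cnj (\<rho> (star a)) = \<rho> a)"

definition dominated_by ::
    "('a::cstar_algebra \<Rightarrow> complex) \<Rightarrow> ('a \<Rightarrow> complex) \<Rightarrow> bool" where
  "dominated_by \<rho> \<omega> \<longleftrightarrow>
     (\<forall>a b. complex_of_real ((cmod (\<rho> (star a * b)))\<^sup>2) \<le> \<omega> (star a * a) * \<omega> (star b * b))"

definition dominated_twisted_KMS_functionals ::
    "(real \<Rightarrow> 'a::cstar_algebra \<Rightarrow> 'a) \<Rightarrow> ('a \<Rightarrow> 'a) \<Rightarrow> real \<Rightarrow> ('a \<Rightarrow> complex) \<Rightarrow> ('a \<Rightarrow> complex) set"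
  where
  "dominated_twisted_KMS_functionals \<alpha> \<gamma> \<beta> \<omega> =
     {\<rho> \<in> twisted_KMS_functionals \<alpha> \<gamma> \<beta>. hermitian_functional \<rho> \<and> dominated_by \<rho> \<omega>}"


section \<open>The crossed product by \<open>\<int>\<^sub>2\<close>\<close>

text \<open>
  The \<open>C\<^sup>*\<close>-norm of \<open>M\<^sub>n(\<A>)\<close> is the operator norm for the action of matrices on the Hilbert
  \<open>\<A>\<close>-module \<open>\<A>\<^sup>n\<close> of column vectors, with inner product \<open>\<langle>v, w\<rangle> = \<Sum>\<^sub>i v\<^sub>i\<^sup>* w\<^sub>i\<close> and norm
  \<open>\<parallel>\<langle>v, v\<rangle>\<parallel>\<^sup>1\<^sup>/\<^sup>2\<close>.
\<close>

definition module_norm :: "'a::cstar_algebra ^ 'n \<Rightarrow> real" where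
  "module_norm v = sqrt (norm (\<Sum>i\<in>UNIV. star (v $ i) * v $ i))"

definition matrix_norm :: "'a::cstar_algebra ^ 'n ^ 'n \<Rightarrow> real" where
  "matrix_norm M = (SUP v\<in>{v. module_norm v \<le> 1}. module_norm (M *v v))"

definition crossed_matrix :: "('a \<Rightarrow> 'a) \<Rightarrow> 'a \<times> 'a \<Rightarrow> 'a::cstar_algebra ^ 2 ^ 2" where
  "crossed_matrix \<gamma> = (\<lambda>(a, b). vector [vector [a, b], vector [\<gamma> b, \<gamma> a]])"

definition crossed_product :: "('a \<Rightarrow> 'a) \<Rightarrow> ('a::cstar_algebra \<times> 'a) cstar_structure" where
  "crossed_product \<gamma> =
     \<lparr>Mult = (\<lambda>(a, b) (a', b'). (a * a' + b * \<gamma> b', a * b' + b * \<gamma> a')),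
      Unit = (1, 0),
      Star = (\<lambda>(a, b). (star a, \<gamma> (star b))),
      Norm = (\<lambda>x. matrix_norm (crossed_matrix \<gamma> x))\<rparr>"

definition crossed_dynamics :: "(real \<Rightarrow> 'a \<Rightarrow> 'a) \<Rightarrow> real \<Rightarrow> 'a \<times> 'a \<Rightarrow> 'a \<times> 'a" where
  "crossed_dynamics \<alpha> t = map_prod (\<alpha> t) (\<alpha> t)"

definition restriction_pair ::
    "('a::zero \<times> 'a \<Rightarrow> complex) \<Rightarrow> ('a \<Rightarrow> complex) \<times> ('a \<Rightarrow> complex)" where
  "restriction_pair \<omega> = (\<lambda>a. \<omega> (a, 0), \<lambda>b. \<omega> (0, b))"

end

theory Submission
  imports Defs "HOL-Complex_Analysis.Complex_Analysis" "HOL-Probability.Sinc_Integral"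
begin

text \<open>
  Write \<open>u = (0, 1)\<close> for the unitary that implements \<open>\<gamma>\<close>, so that \<open>(a, b) = (a, 0) + (b, 0) u\<close>. A
  linear functional on the crossed product is then the same as a pair \<open>(\<omega>, \<rho>)\<close>, and the proof
  translates each property of the functional into properties of the pair.

  \<^item> Applied to \<open>(a, b)\<close>, positivity says \<open>\<omega>(a\<^sup>*a) + \<omega>(\<gamma>(b\<^sup>*b)) + \<rho>(a\<^sup>*b) + \<rho>(\<gamma>(b\<^sup>*a)) \<ge> 0\<close>. If
    \<open>\<omega>\<close> and \<open>\<rho>\<close> are \<open>\<gamma>\<close>-invariant and \<open>\<rho>\<close> is hermitian, this is
    \<open>\<omega>(a\<^sup>*a) + \<omega>(b\<^sup>*b) + 2 Re \<rho>(a\<^sup>*b) \<ge> 0\<close>, which follows from domination; conversely domination is the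
    Cauchy--Schwarz inequality for \<open>(a, 0)\<close> and \<open>(0, b)\<close>.
  \<^item> The KMS condition splits into four conditions, according to which components the two elements
    have. They say that \<open>\<omega>\<close> is KMS, that \<open>\<rho>\<close> is twisted KMS, and the same again with \<open>\<gamma>\<close> inserted.
  \<^item> Invariance is forced. Since \<open>u\<close> is fixed by the dynamics, the KMS condition for \<open>u\<close> and
    \<open>(0, a)\<close> gives \<open>\<omega>(\<gamma>(a)) = \<omega>(a)\<close>, and the twisted KMS condition for \<open>a\<close> and \<open>1\<close> gives
    \<open>\<rho>(\<gamma>(a)) = \<rho>(a)\<close>. Both are obtained for analytic \<open>a\<close> and pass to all \<open>a\<close> by density and
    continuity.

  This algebra is carried out in \<open>KMS_state_restriction\<close> and \<open>KMS_state_of_pair\<close>. It rests on three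
  analytic facts.

  \<^item> The analytic elements of the crossed product are the pairs of analytic elements, with the
    complexified dynamics acting in each component (\<open>complex_dynamics_crossed\<close>). For this the norm
    of the crossed product must be equivalent to the sum of the norms of the components, and the
    point is that \<open>\<parallel>x\<parallel>\<^sup>2 \<le> \<parallel>x\<^sup>*x + y\<^sup>*y\<parallel>\<close> (\<open>norm_power2_le_norm_sum\<close>). This is where positivity in a
    \<open>C\<^sup>*\<close>-algebra enters: every \<open>x\<^sup>*x\<close> is the square of a self-adjoint element. The proof uses no
    spectra; square roots come from the binomial series, norm estimates for self-adjoint
    contractions from unitaries, and lower bounds for norms from norming functionals.
  \<^item> The complexified dynamics is well defined, by the identity theorem for entire functions with
    values in a Banach space (\<open>entire_function_zero_on_reals\<close>), which reduces to the scalar one by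
    norming functionals.
  \<^item> The analytic elements are dense (\<open>analytic_elements_dense\<close>), by Gaussian smoothing.
\<close>

section \<open>Calculation rules in a unital \<open>C\<^sup>*\<close>-algebra\<close>

lemma scaleC_zero_left [simp]: "0 *\<^sub>C (x::'a::complex_vector) = 0"
  using scaleC_add_left[of 0 0 x] by simp

lemma scaleC_zero_right [simp]: "c *\<^sub>C (0::'a::complex_vector) = 0"
  using scaleC_add_right[of c 0 "0::'a"] by simp

lemma scaleC_minus_left: "(- c) *\<^sub>C (x::'a::complex_vector) = - (c *\<^sub>C x)"
  using scaleC_add_left[of c "-c" x] by (simp add: eq_neg_iff_add_eq_0 add.commute)

lemma scaleC_minus_right: "c *\<^sub>C (- x::'a::complex_vector) = - (c *\<^sub>C x)"
  using scaleC_add_right[of c x "-x"] by (simp add: eq_neg_iff_add_eq_0 add.commute)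

lemma scaleC_diff_right: "c *\<^sub>C (x - y::'a::complex_vector) = c *\<^sub>C x - c *\<^sub>C y"
  using scaleC_add_right[of c x "-y"] by (simp add: scaleC_minus_right)

lemma scaleC_diff_left: "(c - d) *\<^sub>C (x::'a::complex_vector) = c *\<^sub>C x - d *\<^sub>C x"
  using scaleC_add_left[of c "-d" x] by (simp add: scaleC_minus_left)

lemmas scaleC_simps = scaleC_add_right scaleC_add_left scaleC_diff_right scaleC_diff_left
  scaleC_minus_left scaleC_minus_right scaleC_scaleC

lemma vector_space_scaleC: "vector_space (scaleC :: complex \<Rightarrow> 'a::complex_vector \<Rightarrow> 'a)"
  by standard (simp_all add: scaleC_simps scaleC_one)

lemma vector_space_complex_mult: "vector_space ((*) :: complex \<Rightarrow> complex \<Rightarrow> complex)"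
  by standard (simp_all add: algebra_simps)

lemma clinear_iff:
  "clinear f \<longleftrightarrow> (\<forall>x y. f (x + y) = f x + f y) \<and> (\<forall>c x. f (c *\<^sub>C x) = c *\<^sub>C f x)"
  by (auto simp: Vector_Spaces.linear_iff vector_space_scaleC)

lemma clinear_functional_iff:
  "clinear_functional f \<longleftrightarrow> (\<forall>x y. f (x + y) = f x + f y) \<and> (\<forall>c x. f (c *\<^sub>C x) = c * f x)"
  by (auto simp: Vector_Spaces.linear_iff vector_space_scaleC vector_space_complex_mult)

lemma star_zero [simp]: "star (0::'a::cstar_algebra) = 0"
  using star_add[of 0 "0::'a"] by simp

lemma star_minus: "star (- x::'a::cstar_algebra) = - star x"
  using star_add[of x "-x"] by (simp add: eq_neg_iff_add_eq_0 add.commute)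

lemma star_diff: "star (x - y::'a::cstar_algebra) = star x - star y"
  using star_add[of x "-y"] by (simp add: star_minus)

lemma star_one [simp]: "star (1::'a::cstar_algebra) = 1"
  using star_mult[of "star 1" "1::'a"] by (simp add: star_star)

lemma star_scaleR: "star (r *\<^sub>R x::'a::cstar_algebra) = r *\<^sub>R star x"
  by (simp add: scaleR_scaleC star_scaleC)

lemmas star_simps = star_add star_diff star_minus star_mult star_star star_scaleC star_scaleR

lemma norm_star [simp]: "norm (star x) = norm (x::'a::cstar_algebra)"
proof -
  have *: "norm y \<le> norm (star y)" for y :: 'a
  proof (cases "norm y = 0")
    case False
    have "(norm y)\<^sup>2 \<le> norm (star y) * norm y"
      using norm_mult_ineq[of "star y" y] by (simp add: cstar_identity)
    with False show ?thesis by (simp add: power2_eq_square)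
  qed simp
  show ?thesis using *[of x] *[of "star x"] by (simp add: star_star)
qed

lemma bounded_linear_star: "bounded_linear (star :: 'a::cstar_algebra \<Rightarrow> 'a)"
  by (rule bounded_linear_intro[where K=1]) (simp_all add: star_simps)

lemma bounded_linear_scaleC: "bounded_linear ((*\<^sub>C) c :: 'a::cstar_algebra \<Rightarrow> 'a)"
  by (rule bounded_linear_intro[where K="cmod c"])
     (simp_all add: scaleC_add_right scaleR_scaleC scaleC_scaleC norm_scaleC mult.commute)

lemma bounded_bilinear_scaleC:
  "bounded_bilinear ((*\<^sub>C) :: complex \<Rightarrow> 'a::cstar_algebra \<Rightarrow> 'a)"
  by (rule bounded_bilinear.intro)
     (auto simp: scaleC_simps scaleR_scaleC norm_scaleC mult.commute scaleR_conv_of_real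
       intro!: exI[of _ 1])

lemma norm_selfadjoint_square:
  "star h = h \<Longrightarrow> norm (h * h) = (norm (h::'a::cstar_algebra))\<^sup>2"
  using cstar_identity[of h] by simp

lemma norm_selfadjoint_power:
  assumes "star h = (h::'a::cstar_algebra)"
  shows "norm (h ^ (2 ^ n)) = norm h ^ (2 ^ n)"
proof (induction n)
  case (Suc n)
  have st: "star (h ^ k) = h ^ k" for k
    by (induction k) (simp_all add: star_mult assms power_commutes)
  have "norm (h ^ (2 ^ Suc n)) = norm (h ^ (2 ^ n) * h ^ (2 ^ n))"
    by (simp add: power_add[symmetric] mult_2)
  also have "\<dots> = (norm (h ^ (2 ^ n)))\<^sup>2" by (rule norm_selfadjoint_square[OF st])
  finally show ?case by (simp add: Suc.IH power_mult[symmetric] mult.commute)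
qed simp

section \<open>Square roots\<close>

text \<open>
  These are the absolute values of the coefficients of \<open>(1 - x)\<^sup>1\<^sup>/\<^sup>2\<close>. All coefficients but the first,
  which is 1, are nonpositive, so the sum is \<open>2\<close> minus the partial sum of the signed coefficients,
  and the latter is \<open>(-1)\<^sup>k\<close> times a binomial coefficient of \<open>-1/2\<close>, which is nonnegative.
\<close>

lemma sum_abs_sqrt_coeffs_le_2:
  "(\<Sum>n<m. \<bar>(1/2 gchoose n) * (-1)^n\<bar>) \<le> (2::real)"
proof -
  have neg: "((1/2::real) gchoose (Suc n)) * (-1)^(Suc n) \<le> 0" for n
  proof (induction n)
    case (Suc n)
    have "((1/2::real) gchoose (Suc (Suc n))) * (-1)^(Suc (Suc n))
        = ((1/2 gchoose (Suc n)) * (-1)^(Suc n)) * ((real n + 1/2) / (real n + 2))"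
      by (simp add: gbinomial_prod_rev prod.atLeast0_lessThan_Suc field_simps)
    then show ?case using Suc by (simp add: mult_nonpos_nonneg)
  qed simp
  have pos: "((-1/2::real) gchoose n) * (-1)^n \<ge> 0" for n
  proof (induction n)
    case (Suc n)
    have "((-1/2::real) gchoose (Suc n)) * (-1)^(Suc n)
        = ((-1/2 gchoose n) * (-1)^n) * ((real n + 1/2) / (real n + 1))"
      by (simp add: gbinomial_prod_rev prod.atLeast0_lessThan_Suc field_simps)
    then show ?case using Suc by simp
  qed simp
  show ?thesis
  proof (cases m)
    case (Suc k)
    have "(\<Sum>n<m. \<bar>((1/2::real) gchoose n) * (-1)^n\<bar>)
        = 1 + (\<Sum>n<k. \<bar>(1/2 gchoose Suc n) * (-1)^Suc n\<bar>)"
      unfolding Suc by (subst sum.lessThan_Suc_shift) simp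
    also have "\<dots> = 1 - (\<Sum>n<k. (1/2 gchoose Suc n) * (-1)^Suc n)"
      using neg by (simp add: abs_of_nonpos sum_negf del: power_Suc)
    also have "\<dots> = 2 - (\<Sum>n<Suc k. (1/2 gchoose n) * (-1)^n)"
      by (subst sum.lessThan_Suc_shift) simp
    also have "\<dots> = 2 - (-1/2 gchoose k) * (-1)^k"
      unfolding lessThan_Suc_atMost gbinomial_sum_lower_neg by (simp add: mult.commute)
    also have "\<dots> \<le> 2" using pos[of k] by simp
    finally show ?thesis .
  qed simp
qed

text \<open>
  As the coefficients of the binomial series of \<open>(1 - x)\<^sup>1\<^sup>/\<^sup>2\<close> are absolutely summable, the series
  still converges for \<open>\<parallel>x\<parallel> = 1\<close>. Vandermonde's convolution shows that it squares to \<open>1 - x\<close>; the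
  coefficients other than the first have absolute sum at most 1, whence the bound on \<open>1 - y\<close>.
\<close>

lemma exists_sqrt:
  fixes x :: "'a::cstar_algebra"
  assumes "norm x \<le> 1"
  obtains y where "y * y = 1 - x" and "norm (1 - y) \<le> 1"
    and "star x = x \<Longrightarrow> star y = y" and "\<And>z. z * x = x * z \<Longrightarrow> z * y = y * z"
proof -
  define c :: "nat \<Rightarrow> real" where "c n = (1/2 gchoose n) * (-1)^n" for n
  define f where "f n = c n *\<^sub>R x ^ n" for n
  have csum: "summable (\<lambda>n. \<bar>c n\<bar>)"
    using sum_abs_sqrt_coeffs_le_2 unfolding c_def by (intro summableI_nonneg_bounded[where x=2]) auto
  have fle: "norm (f n) \<le> \<bar>c n\<bar>" for n
  proof -
    have "norm (x ^ n) \<le> 1"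
      using norm_power_ineq[of x n] power_le_one[OF norm_ge_zero assms, of n] by linarith
    then show ?thesis by (simp add: f_def mult_left_le)
  qed
  have nsum: "summable (\<lambda>n. norm (f n))"
    by (rule summable_comparison_test'[OF csum, of 0]) (simp add: fle)
  have sumf: "summable f" using nsum by (rule summable_norm_cancel)
  define y where "y = suminf f"
  have fs: "f sums y" using sumf by (simp add: y_def summable_sums)
  have conv: "(\<Sum>i\<le>k. f i * f (k - i)) = (if k = 0 then 1 else if k = 1 then - x else 0)" for k
  proof -
    have "(\<Sum>i\<le>k. f i * f (k - i))
        = (\<Sum>i\<le>k. ((1/2 gchoose i) * (1/2 gchoose (k - i)) * (-1)^k) *\<^sub>R x ^ k)"
      by (intro sum.cong refl) (simp add: f_def c_def power_add[symmetric] flip: power_add)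
    also have "\<dots> = ((\<Sum>i=0..k. (1/2 gchoose i) * (1/2 gchoose (k - i))) * (-1)^k) *\<^sub>R x ^ k"
      by (simp add: scaleR_sum_left sum_distrib_right atMost_atLeast0)
    also have "\<dots> = ((1 gchoose k) * (-1)^k) *\<^sub>R x ^ k"
      by (simp add: gbinomial_Vandermonde)
    also have "((1::real) gchoose k) = (if k \<le> 1 then 1 else 0)"
      using binomial_gbinomial[of 1 k, where 'a=real, symmetric]
      by (cases "k = 0"; cases "k = 1") (simp_all add: binomial_eq_0)
    finally show ?thesis by (auto simp: le_Suc_eq)
  qed
  have "(\<lambda>k. \<Sum>i\<le>k. f i * f (k - i)) sums (y * y)"
    unfolding y_def by (rule Cauchy_product_sums[OF nsum nsum])
  moreover have "(\<lambda>k. if k = 0 then 1 else if k = 1 then - x else 0) sums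
      (\<Sum>k\<in>{0,1::nat}. if k = 0 then 1 else if k = 1 then - x else (0::'a))"
    by (rule sums_finite) auto
  ultimately have 1: "y * y = 1 - x"
    unfolding conv using sums_unique2 by fastforce
  have f0: "f 0 = 1" by (simp add: f_def c_def)
  have c0: "c 0 = 1" by (simp add: c_def)
  have "1 - y = - (\<Sum>n. f (Suc n))"
    using suminf_split_head[OF sumf] by (simp add: y_def f0)
  then have "norm (1 - y) = norm (\<Sum>n. f (Suc n))" by simp
  also have "\<dots> \<le> (\<Sum>n. \<bar>c (Suc n)\<bar>)"
  proof -
    have s1: "summable (\<lambda>n. norm (f (Suc n)))" using nsum by (subst summable_Suc_iff)
    have s2: "summable (\<lambda>n. \<bar>c (Suc n)\<bar>)"
      using summable_Suc_iff[of "\<lambda>n. \<bar>c n\<bar>"] csum by simp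
    show ?thesis
      by (rule order_trans[OF summable_norm[OF s1] suminf_le[OF fle s1 s2]])
  qed
  also have "\<dots> = (\<Sum>n. \<bar>c n\<bar>) - 1" using suminf_split_head[OF csum] c0 by simp
  also have "(\<Sum>n. \<bar>c n\<bar>) \<le> 2"
    using sum_abs_sqrt_coeffs_le_2 by (intro suminf_le_const[OF csum]) (simp add: c_def)
  finally have 2: "norm (1 - y) \<le> 1" by simp
  have 3: "star y = y" if "star x = x"
  proof -
    have "star (x ^ n) = x ^ n" for n
      by (induction n) (simp_all add: star_mult that power_commutes)
    then have "(\<lambda>n. star (f n)) = f" by (simp add: f_def star_scaleR fun_eq_iff)
    with bounded_linear.sums[OF bounded_linear_star fs] have "f sums star y" by simp
    with fs show ?thesis by (simp add: sums_unique2)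
  qed
  have 4: "z * y = y * z" if "z * x = x * z" for z
  proof -
    have "z * x ^ n = x ^ n * z" for n by (metis power_commuting_commutes that)
    then have "(\<lambda>n. z * f n) = (\<lambda>n. f n * z)" by (simp add: f_def fun_eq_iff)
    with sums_mult[OF fs, of z] sums_mult2[OF fs, of z] show ?thesis
      using sums_unique2 by fastforce
  qed
  from that[OF 1 2 3 4] show ?thesis by blast
qed

text \<open>
  A self-adjoint contraction is the real part of the unitary \<open>u = h + i(1 - h\<^sup>2)\<^sup>1\<^sup>/\<^sup>2\<close>. Unitaries have
  norm 1 and are preserved by unital \<open>\<^sup>*\<close>-homomorphisms, and this replaces the use of the spectral
  radius below.
\<close>

lemma selfadjoint_contraction_unitary:
  fixes h :: "'a::cstar_algebra"
  assumes "star h = h" "norm h \<le> 1"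
  obtains u where "star u * u = 1" "u * star u = 1" "h = (1/2) *\<^sub>R (u + star u)"
proof -
  have "norm (h * h) \<le> 1"
    using assms by (simp add: norm_selfadjoint_square power_le_one)
  then obtain y where y: "y * y = 1 - h * h" "star y = y" "h * y = y * h"
    using exists_sqrt[of "h * h"] by (metis assms(1) mult.assoc star_mult)
  define u where "u = h + \<i> *\<^sub>C y"
  have su: "star u = h - \<i> *\<^sub>C y"
    by (simp add: u_def star_simps assms y scaleC_minus_left)
  show ?thesis
  proof (rule that[of u])
    show "star u * u = 1" "u * star u = 1" unfolding su
      by (simp_all add: u_def algebra_simps mult_scaleC_left mult_scaleC_right scaleC_simps scaleC_one y)
    show "h = (1/2) *\<^sub>R (u + star u)" unfolding su
      by (simp add: u_def flip: scaleR_2)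
  qed
qed

lemma norm_unitary_le_1: "star u * u = 1 \<Longrightarrow> norm (u::'a::cstar_algebra) \<le> 1"
  using cstar_identity[of u] by (auto simp: power2_eq_1_iff)

text \<open>
  With \<open>h\<close> the real part of the unitary \<open>u\<close>, this is the doubling formula \<open>2 cos\<^sup>2 - 1 = cos(2\<cdot>)\<close>: the
  element \<open>2h\<^sup>2 - 1\<close> is the real part of \<open>u\<^sup>2\<close>.
\<close>

lemma selfadjoint_contraction_square:
  fixes h :: "'a::cstar_algebra"
  assumes "star h = h" "norm h \<le> 1"
  shows "norm (2 *\<^sub>R (h * h) - 1) \<le> 1"
proof -
  obtain u where u: "star u * u = 1" "u * star u = 1" "h = (1/2) *\<^sub>R (u + star u)"
    by (rule selfadjoint_contraction_unitary[OF assms])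
  have "4 *\<^sub>R (h * h) = u * u + star u * star u + 2 *\<^sub>R 1"
    unfolding u(3) using u(1,2) by (simp add: algebra_simps scaleR_2)
  then have "2 *\<^sub>R (2 *\<^sub>R (h * h) - 1) = u * u + star u * star u"
    by (simp add: scaleR_diff_right)
  then have "2 * norm (2 *\<^sub>R (h * h) - 1) = norm (u * u + star u * star u)"
    by (metis norm_scaleR abs_numeral)
  also have "\<dots> \<le> norm (u * u) + norm (star u * star u)" by (rule norm_triangle_ineq)
  also have "\<dots> \<le> 1 + 1"
    using norm_unitary_le_1[OF u(1)]
    by (intro add_mono order_trans[OF norm_mult_ineq] mult_le_one) auto
  finally show ?thesis by simp
qed

section \<open>Norming functionals\<close>

definition sublinear :: "('v::real_vector \<Rightarrow> real) \<Rightarrow> bool" where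
  "sublinear p \<longleftrightarrow> p 0 = 0 \<and> (\<forall>x y. p (x + y) \<le> p x + p y) \<and>
     (\<forall>c x. 0 < c \<longrightarrow> p (c *\<^sub>R x) \<le> c * p x)"

lemma sublinear_scale:
  assumes "sublinear p" "0 \<le> c" shows "p (c *\<^sub>R x) = c * p x"
proof (cases "c = 0")
  case False
  then have c: "c > 0" using assms(2) by simp
  then have "p ((1/c) *\<^sub>R (c *\<^sub>R x)) \<le> (1/c) * p (c *\<^sub>R x)"
    using assms(1) unfolding sublinear_def by (metis zero_less_divide_1_iff)
  then have "c * p x \<le> p (c *\<^sub>R x)" using c by (simp add: field_simps)
  then show ?thesis using assms(1) c unfolding sublinear_def by (meson order_antisym)
qed (use assms in \<open>simp add: sublinear_def\<close>)

lemma sublinear_lower: "sublinear p \<Longrightarrow> - p (- x) \<le> p x"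
  unfolding sublinear_def by (metis add.right_inverse add.commute diff_0 diff_le_eq)

text \<open>
  The Hahn--Banach theorem is proved by way of minimal sublinear functionals, which turn out to be
  linear. The infimum below is the largest sublinear functional that lies below \<open>q\<close> and whose
  value at \<open>- y\<close> is at most \<open>- q y\<close>; a minimal \<open>q\<close> must agree with it for every \<open>y\<close>.
\<close>

definition sublinear_shift :: "('v::real_vector \<Rightarrow> real) \<Rightarrow> 'v \<Rightarrow> 'v \<Rightarrow> real" where
  "sublinear_shift q y x = (INF t\<in>{0..}. q (x + t *\<^sub>R y) - t * q y)"

lemma sublinear_shift_le:
  assumes q: "sublinear q" and t: "0 \<le> t"
  shows "sublinear_shift q y x \<le> q (x + t *\<^sub>R y) - t * q y"
proof -
  have "- q (- x) \<le> q (x + t *\<^sub>R y) - t * q y" if "0 \<le> t" for t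
  proof -
    have "q ((x + t *\<^sub>R y) + - x) \<le> q (x + t *\<^sub>R y) + q (- x)"
      using q unfolding sublinear_def by blast
    then show ?thesis using sublinear_scale[OF q that, of y] by simp
  qed
  then have "bdd_below ((\<lambda>t. q (x + t *\<^sub>R y) - t * q y) ` {0..})"
    by (intro bdd_belowI2[where m="- q (- x)"]) simp
  then show ?thesis unfolding sublinear_shift_def by (rule cINF_lower) (simp add: t)
qed

lemma sublinear_shift_greatest:
  "(\<And>t. 0 \<le> t \<Longrightarrow> m \<le> q (x + t *\<^sub>R y) - t * q y) \<Longrightarrow> m \<le> sublinear_shift q y x"
  unfolding sublinear_shift_def by (rule cINF_greatest) auto

lemma sublinear_sublinear_shift:
  assumes q: "sublinear q"
  shows "sublinear (sublinear_shift q y)"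
  unfolding sublinear_def
proof (intro conjI allI impI)
  have "sublinear_shift q y 0 \<le> 0"
    using sublinear_shift_le[OF q, of 0 y 0] q by (simp add: sublinear_def)
  moreover have "0 \<le> sublinear_shift q y 0"
    by (rule sublinear_shift_greatest) (simp add: sublinear_scale[OF q])
  ultimately show "sublinear_shift q y 0 = 0" by simp
next
  fix x x'
  have *: "sublinear_shift q y (x + x') \<le> (q (x + s *\<^sub>R y) - s * q y) + (q (x' + t *\<^sub>R y) - t * q y)"
    if "0 \<le> s" "0 \<le> t" for s t
  proof -
    have "q ((x + s *\<^sub>R y) + (x' + t *\<^sub>R y)) \<le> q (x + s *\<^sub>R y) + q (x' + t *\<^sub>R y)"
      using q unfolding sublinear_def by blast
    then show ?thesis
      using sublinear_shift_le[OF q, of "s + t" y "x + x'"] that by (simp add: algebra_simps)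
  qed
  have "sublinear_shift q y (x + x') - (q (x + s *\<^sub>R y) - s * q y) \<le> sublinear_shift q y x'"
    if "0 \<le> s" for s
    by (rule sublinear_shift_greatest) (use *[OF that] in \<open>simp add: algebra_simps\<close>)
  then have "sublinear_shift q y (x + x') - sublinear_shift q y x' \<le> sublinear_shift q y x"
    by (intro sublinear_shift_greatest) (simp add: algebra_simps)
  then show "sublinear_shift q y (x + x') \<le> sublinear_shift q y x + sublinear_shift q y x'"
    by simp
next
  fix c :: real and x assume c: "0 < c"
  have "sublinear_shift q y (c *\<^sub>R x) / c \<le> sublinear_shift q y x"
  proof (rule sublinear_shift_greatest)
    fix t :: real assume t: "0 \<le> t"
    have "sublinear_shift q y (c *\<^sub>R x) \<le> q (c *\<^sub>R (x + t *\<^sub>R y)) - c * t * q y"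
      using sublinear_shift_le[OF q, of "c * t" y "c *\<^sub>R x"] c t by (simp add: scaleR_add_right)
    also have "\<dots> = c * (q (x + t *\<^sub>R y) - t * q y)"
      using c by (simp add: sublinear_scale[OF q] right_diff_distrib)
    finally show "sublinear_shift q y (c *\<^sub>R x) / c \<le> q (x + t *\<^sub>R y) - t * q y"
      using c by (simp add: field_simps)
  qed
  then show "sublinear_shift q y (c *\<^sub>R x) \<le> c * sublinear_shift q y x"
    using c by (simp add: field_simps)
qed

lemma exists_minimal_sublinear:
  assumes p: "sublinear (p :: 'v::real_vector \<Rightarrow> real)"
  obtains q where "sublinear q" "q \<le> p" "\<And>r. sublinear r \<Longrightarrow> r \<le> q \<Longrightarrow> r = q"
proof -
  define A where "A = {q. sublinear q \<and> q \<le> p}"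
  have "\<exists>m\<in>A. \<forall>a\<in>A. m \<ge> a \<longrightarrow> a = m"
  proof (rule predicate_Zorn)
    show "partial_order_on A (relation_of (\<ge>) A)"
      by (auto simp: partial_order_on_def preorder_on_def refl_on_def trans_def antisym_def
          relation_of_def)
  next
    fix C assume C: "C \<in> Chains (relation_of (\<ge>) A)"
    have CA: "sublinear q" "q \<le> p" if "q \<in> C" for q
      using C that by (auto simp: Chains_def relation_of_def A_def)
    have tot: "q \<le> r \<or> r \<le> q" if "q \<in> C" "r \<in> C" for q r
      using C that by (auto simp: Chains_def relation_of_def)
    show "\<exists>u\<in>A. \<forall>a\<in>C. a \<ge> u"
    proof (cases "C = {}")
      case False
      define u where "u x = (INF q\<in>C. q x)" for x
      have bdd: "bdd_below ((\<lambda>q. q x) ` C)" for x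
      proof (rule bdd_belowI2[where m="- p (- x)"])
        fix q assume "q \<in> C"
        then show "- p (- x) \<le> q x"
          using CA[of q] sublinear_lower[of q x] le_funD[of q p "- x"] by auto
      qed
      have ule: "u x \<le> q x" if "q \<in> C" for q x
        unfolding u_def by (rule cINF_lower[OF bdd that])
      have ugr: "m \<le> u x" if "\<And>q. q \<in> C \<Longrightarrow> m \<le> q x" for m x
        unfolding u_def by (rule cINF_greatest[OF False that])
      have "sublinear u" unfolding sublinear_def
      proof (intro conjI allI impI)
        have "(\<lambda>q. q 0) ` C = {0}" using CA(1) False by (force simp: sublinear_def)
        then show "u 0 = 0" by (simp add: u_def)
      next
        fix x y
        have *: "u (x + y) \<le> q x + r y" if qr: "q \<in> C" "r \<in> C" for q r
          using tot[OF qr]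
        proof
          assume "q \<le> r"
          then have "q x + q y \<le> q x + r y" by (simp add: le_fun_def)
          moreover have "q (x + y) \<le> q x + q y" using CA(1)[OF qr(1)] by (simp add: sublinear_def)
          ultimately show ?thesis using ule[OF qr(1), of "x + y"] by linarith
        next
          assume "r \<le> q"
          then have "r x + r y \<le> q x + r y" by (simp add: le_fun_def)
          moreover have "r (x + y) \<le> r x + r y" using CA(1)[OF qr(2)] by (simp add: sublinear_def)
          ultimately show ?thesis using ule[OF qr(2), of "x + y"] by linarith
        qed
        have "u (x + y) - q x \<le> u y" if "q \<in> C" for q
          by (rule ugr) (use *[OF that] in \<open>simp add: algebra_simps\<close>)
        then have "u (x + y) - u y \<le> u x" by (intro ugr) (simp add: algebra_simps)
        then show "u (x + y) \<le> u x + u y" by simp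
      next
        fix c :: real and x assume c: "0 < c"
        have "u (c *\<^sub>R x) / c \<le> u x"
        proof (rule ugr)
          fix q assume q: "q \<in> C"
          have "u (c *\<^sub>R x) \<le> c * q x"
            using ule[OF q, of "c *\<^sub>R x"] c by (simp add: sublinear_scale[OF CA(1)[OF q]])
          then show "u (c *\<^sub>R x) / c \<le> q x" using c by (simp add: field_simps)
        qed
        then show "u (c *\<^sub>R x) \<le> c * u x" using c by (simp add: field_simps)
      qed
      moreover have "u \<le> p"
        using False CA(2) ule by (metis (no_types, opaque_lifting) ex_in_conv le_funI le_funD order_trans)
      ultimately show ?thesis using ule by (auto simp: A_def le_fun_def)
    qed (use p in \<open>auto simp: A_def\<close>)
  qed
  then show ?thesis using that unfolding A_def by (metis (mono_tags, lifting) mem_Collect_eq order_trans)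
qed

text \<open>
  A minimal sublinear functional \<open>q\<close> equals its shifts, so \<open>q x \<le> q (x + y) - q y\<close>; with
  subadditivity this makes it additive. Minimizing below the shift of the norm in direction \<open>a\<close>,
  rather than below the norm itself, forces \<open>q (- a) \<le> - \<parallel>a\<parallel>\<close>.
\<close>

lemma exists_norming_functional:
  fixes a :: "'v::real_normed_vector"
  obtains f :: "'v \<Rightarrow> real" where "linear f" "\<And>x. \<bar>f x\<bar> \<le> norm x" "f a = norm a"
proof -
  have n: "sublinear (norm :: 'v \<Rightarrow> real)"
    by (simp add: sublinear_def norm_triangle_ineq)
  obtain q where q: "sublinear q" "q \<le> sublinear_shift norm a"
    and min: "\<And>r. sublinear r \<Longrightarrow> r \<le> q \<Longrightarrow> r = q"
    using exists_minimal_sublinear[OF sublinear_sublinear_shift[OF n, of a]] by blast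
  have shift: "sublinear_shift q y = q" for y
  proof (rule min[OF sublinear_sublinear_shift[OF q(1)]])
    show "sublinear_shift q y \<le> q"
      using sublinear_shift_le[OF q(1), of 0 y] by (auto simp: le_fun_def)
  qed
  have add: "q (x + y) = q x + q y" for x y
  proof (rule antisym)
    show "q (x + y) \<le> q x + q y" using q(1) by (simp add: sublinear_def)
    show "q x + q y \<le> q (x + y)"
      using sublinear_shift_le[OF q(1), of 1 y x] by (simp add: shift)
  qed
  have minus: "q (- x) = - q x" for x
    using add[of x "- x"] q(1) by (simp add: sublinear_def)
  have scale: "q (c *\<^sub>R x) = c * q x" for c x
  proof (cases "0 \<le> c")
    case False
    then show ?thesis using sublinear_scale[OF q(1), of "- c" x] minus[of "c *\<^sub>R x"] by simp
  qed (simp add: sublinear_scale[OF q(1)])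
  have le: "q x \<le> norm x" for x
    using le_funD[OF q(2), of x] sublinear_shift_le[OF n, of 0 a x] by simp
  have "q (- a) \<le> - norm a"
    using le_funD[OF q(2), of "- a"] sublinear_shift_le[OF n, of 1 a "- a"] by simp
  then have "q a = norm a" using le[of a] by (simp add: minus)
  moreover have "\<bar>q x\<bar> \<le> norm x" for x
    using le[of x] le[of "- x"] by (simp add: minus abs_le_iff)
  ultimately show ?thesis using that[of q] by (simp add: linear_iff add scale)
qed

section \<open>Positivity\<close>

text \<open>
  Real parts of states, seen as real functionals. Whether such a functional is real on
  self-adjoint elements is then no issue, and positivity comes from the norm alone: a functional of
  norm 1 with value 1 at the unit is nonnegative at every \<open>p\<close> with \<open>\<parallel>1 - p\<parallel> \<le> 1\<close>.
\<close>

definition real_state :: "('a::cstar_algebra \<Rightarrow> real) \<Rightarrow> bool" where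
  "real_state f \<longleftrightarrow> linear f \<and> (\<forall>x. \<bar>f x\<bar> \<le> norm x) \<and> f 1 = 1"

lemma real_state_nonneg:
  assumes "real_state f" "norm (1 - p) \<le> 1" shows "0 \<le> f p"
proof -
  have "f (1 - p) = 1 - f p" using assms(1) by (simp add: real_state_def linear_diff)
  moreover have "\<bar>f (1 - p)\<bar> \<le> 1" using assms unfolding real_state_def by (meson order_trans)
  ultimately show ?thesis by linarith
qed

lemma norm_one_minus_square_le:
  fixes h :: "'a::cstar_algebra"
  assumes "star h = h" "norm h \<le> 1"
  shows "norm (1 - h * h) \<le> 1"
proof -
  have "2 *\<^sub>R (1 - h * h) = 1 - (2 *\<^sub>R (h * h) - 1)" by (simp add: algebra_simps scaleR_2)
  then have "2 * norm (1 - h * h) = norm (1 - (2 *\<^sub>R (h * h) - 1))"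
    by (metis norm_scaleR abs_numeral)
  also have "\<dots> \<le> norm (1::'a) + norm (2 *\<^sub>R (h * h) - 1)" by (rule norm_triangle_ineq4)
  finally show ?thesis using selfadjoint_contraction_square[OF assms] by simp
qed

lemma real_state_square_nonneg:
  assumes f: "real_state f" and h: "star h = h"
  shows "0 \<le> f (h * h)"
proof (cases "h = 0")
  case False
  define g where "g = (1 / norm h) *\<^sub>R h"
  have g: "star g = g" "norm g \<le> 1" using False by (simp_all add: g_def star_scaleR h)
  have "0 \<le> f (g * g)" by (rule real_state_nonneg[OF f norm_one_minus_square_le[OF g]])
  moreover have "f (g * g) = (1 / norm h)\<^sup>2 * f (h * h)"
    using f by (simp add: g_def real_state_def linear_scale power2_eq_square)
  ultimately show ?thesis using False by (simp add: zero_le_mult_iff)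
qed (use f in \<open>simp add: real_state_def linear_0\<close>)

text \<open>
  For \<open>\<parallel>g\<parallel> = 1\<close> it suffices that \<open>\<parallel>1 + g\<^sup>2\<parallel> \<ge> 2\<close>: a functional that norms \<open>1 + g\<^sup>2\<close> then takes the
  value 1 at both summands. This bound holds because \<open>g\<^sup>2 = (2/3)(g\<^sup>2 - 1/2) + (1/3)(1 + g\<^sup>2)\<close> has norm
  1, while \<open>\<parallel>g\<^sup>2 - 1/2\<parallel> \<le> 1/2\<close>.
\<close>

lemma exists_norming_real_state:
  fixes h :: "'a::cstar_algebra"
  assumes h: "star h = h"
  obtains f where "real_state f" "f (h * h) = (norm h)\<^sup>2"
proof (cases "h = 0")
  case True
  obtain f :: "'a \<Rightarrow> real" where "linear f" "\<And>x. \<bar>f x\<bar> \<le> norm x" "f 1 = norm (1::'a)"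
    using exists_norming_functional[of "1::'a"] by blast
  then show ?thesis using that[of f] True by (simp add: real_state_def linear_0)
next
  case False
  define g where "g = (1 / norm h) *\<^sub>R h"
  have g: "star g = g" "norm g = 1" using False by (simp_all add: g_def star_scaleR h)
  have gg: "norm (g * g) = 1" using norm_selfadjoint_square[OF g(1)] g(2) by simp
  have "3 *\<^sub>R (g * g) = (2 *\<^sub>R (g * g) - 1) + (1 + g * g)"
    by (simp flip: scaleR_left.add[of 2 1, simplified])
  then have "norm (3 *\<^sub>R (g * g)) \<le> norm (2 *\<^sub>R (g * g) - 1) + norm (1 + g * g)"
    by (metis norm_triangle_ineq)
  also have "norm (2 *\<^sub>R (g * g) - 1) \<le> 1" using selfadjoint_contraction_square[of g] g by simp
  finally have n2: "2 \<le> norm (1 + g * g)" by (simp add: gg)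
  obtain f :: "'a \<Rightarrow> real"
    where f: "linear f" "\<And>x. \<bar>f x\<bar> \<le> norm x" "f (1 + g * g) = norm (1 + g * g)"
    using exists_norming_functional[of "1 + g * g"] by blast
  have "f 1 + f (g * g) \<ge> 2" using f(1,3) n2 by (simp add: linear_add)
  then have f1: "f 1 = 1" "f (g * g) = 1" using f(2)[of 1] f(2)[of "g * g"] gg by simp_all
  have "h * h = (norm h)\<^sup>2 *\<^sub>R (g * g)" using False by (simp add: g_def power2_eq_square)
  then have "f (h * h) = (norm h)\<^sup>2" using f(1) f1 by (simp add: linear_scale)
  then show ?thesis using that[of f] f f1 by (simp add: real_state_def)
qed

text \<open>
  Linear growth along the powers of 2 contradicts even the quadratic growth that Bernoulli's
  inequality gives for the powers of a number above 1.
\<close>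

lemma power_le_linear_imp_le_1:
  fixes r :: real
  assumes r: "0 \<le> r" and bound: "\<And>n. r ^ (2 ^ n) \<le> 1 + 2 ^ n"
  shows "r \<le> 1"
proof (rule ccontr)
  assume "\<not> r \<le> 1"
  then have d: "r - 1 > 0" by simp
  \<comment> \<open>For \<open>M = 2\<^sup>n\<close>, the bound for \<open>2M\<close> and Bernoulli's inequality for \<open>M\<close>
    give \<open>M\<^sup>2 (r - 1)\<^sup>2 \<le> 1 + 2M \<le> 3M\<close>, which this choice of \<open>n\<close> violates.\<close>
  obtain n where n: "3 / (r - 1)\<^sup>2 < 2 ^ n"
    using real_arch_pow[of 2 "3 / (r - 1)\<^sup>2"] by auto
  define M :: real where "M = 2 ^ n"
  have M1: "M \<ge> 1" by (simp add: M_def)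
  have "1 + M * (r - 1) \<le> r ^ (2 ^ n)"
    using Bernoulli_inequality[of "r - 1" "2 ^ n"] d by (simp add: M_def)
  then have "M * (r - 1) \<le> r ^ (2 ^ n)" by simp
  then have "(M * (r - 1))\<^sup>2 \<le> (r ^ (2 ^ n))\<^sup>2" using d M1 by (intro power_mono) auto
  also have "\<dots> = r ^ (2 ^ Suc n)" by (simp add: power_mult[symmetric] mult.commute)
  also have "\<dots> \<le> 1 + 2 * M" using bound[of "Suc n"] by (simp add: M_def)
  also have "\<dots> \<le> 3 * M" using M1 by simp
  finally have "M * (M * (r - 1)\<^sup>2) \<le> M * 3" by (simp add: power2_eq_square ac_simps)
  then have "M * (r - 1)\<^sup>2 \<le> 3" using M1 by simp
  moreover have "3 < M * (r - 1)\<^sup>2" using n d by (simp add: M_def field_simps)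
  ultimately show False by simp
qed

text \<open>
  This stands in for the fact that \<open>z\<^sup>*z\<close> and \<open>z z\<^sup>*\<close> have the same spectrum up to 0. From
  \<open>(1 + z z\<^sup>*)\<^sup>m = 1 + z (\<Sum>\<^sub>j\<^sub><\<^sub>m (1 + z\<^sup>*z)\<^sup>j) z\<^sup>*\<close> the powers of the self-adjoint element \<open>1 + z z\<^sup>*\<close> grow
  at most linearly, and \<open>\<parallel>w\<^sup>m\<parallel> = \<parallel>w\<parallel>\<^sup>m\<close> for self-adjoint \<open>w\<close> and \<open>m\<close> a power of 2.
\<close>

lemma norm_one_plus_mult_star_le:
  fixes z :: "'a::cstar_algebra"
  assumes z: "norm z \<le> 1" and v: "norm (1 + star z * z) \<le> 1"
  shows "norm (1 + z * star z) \<le> 1"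
proof (rule power_le_linear_imp_le_1)
  let ?w = "1 + z * star z" and ?v = "1 + star z * z"
  have pow: "?w ^ m = 1 + z * (\<Sum>j<m. ?v ^ j) * star z" for m
  proof (induction m)
    case (Suc m)
    have "?w ^ Suc m = (1 + z * (\<Sum>j<m. ?v ^ j) * star z) * ?w"
      unfolding Suc.IH[symmetric] by (rule power_Suc2)
    also have "\<dots> = 1 + z * (1 + (\<Sum>j<m. ?v ^ j) * ?v) * star z"
      by (simp add: algebra_simps)
    also have "1 + (\<Sum>j<m. ?v ^ j) * ?v = (\<Sum>j<Suc m. ?v ^ j)"
      by (simp add: sum.lessThan_Suc_shift sum_distrib_right power_Suc2 del: sum.lessThan_Suc power_Suc)
    finally show ?case .
  qed simp
  fix n :: nat
  have st: "star ?w = ?w" by (simp add: star_simps)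
  have "norm (\<Sum>j<2^n. ?v ^ j) \<le> (\<Sum>j<(2::nat)^n. 1::real)"
    using v by (intro order_trans[OF norm_sum] sum_mono order_trans[OF norm_power_ineq] power_le_one)
      auto
  then have S: "norm (\<Sum>j<2^n. ?v ^ j) \<le> 2 ^ n" by simp
  have "norm (z * (\<Sum>j<2^n. ?v ^ j) * star z) \<le> norm z * norm (\<Sum>j<2^n. ?v ^ j) * norm z"
    using order_trans[OF norm_mult_ineq mult_right_mono[OF norm_mult_ineq norm_ge_zero],
        of z "\<Sum>j<2^n. ?v ^ j" "star z"]
    by simp
  also have "\<dots> \<le> 1 * 2 ^ n * 1"
    using z S by (intro mult_mono) auto
  finally have "norm (?w ^ (2 ^ n)) \<le> 1 + 2 ^ n"
    unfolding pow by (intro order_trans[OF norm_triangle_ineq]) simp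
  then show "norm ?w ^ 2 ^ n \<le> 1 + 2 ^ n" by (simp add: norm_selfadjoint_power[OF st])
qed simp

text \<open>
  If \<open>z\<^sup>*z\<close> is negative then so is \<open>z z\<^sup>*\<close>. But with \<open>z = a + ib\<close> split into real and imaginary part,
  \<open>z z\<^sup>* + z\<^sup>*z = 2(a\<^sup>2 + b\<^sup>2)\<close> is positive, and testing with functionals that norm \<open>a\<^sup>2\<close> and \<open>b\<^sup>2\<close> gives
  \<open>a = b = 0\<close>.
\<close>

lemma star_mult_self_eq_minus_square_imp_zero:
  fixes z :: "'a::cstar_algebra"
  assumes "star z * z = - (q * q)" "star q = q"
  shows "z = 0"
proof (rule ccontr)
  assume z0: "z \<noteq> 0"
  define y where "y = (1 / norm z) *\<^sub>R z"
  define p where "p = (1 / norm z) *\<^sub>R q"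
  have ny: "norm y = 1" using z0 by (simp add: y_def)
  have sp: "star p = p" by (simp add: p_def star_scaleR assms)
  have yp: "star y * y = - (p * p)" by (simp add: y_def p_def star_scaleR assms)
  have "(norm p)\<^sup>2 = 1"
    using norm_selfadjoint_square[OF sp] cstar_identity[of y] by (simp add: yp ny)
  then have np: "norm p \<le> 1" by (auto simp: power2_eq_1_iff)
  have "norm (1 + star y * y) \<le> 1"
    using norm_one_minus_square_le[OF sp np] by (simp add: yp)
  then have w: "norm (1 - - (y * star y)) \<le> 1"
    using norm_one_plus_mult_star_le[of y] ny by simp
  define a where "a = (1/2) *\<^sub>R (y + star y)"
  define b where "b = ((1/2) *\<^sub>R (\<i> *\<^sub>C (star y - y)))"
  have sa: "star a = a" by (simp add: a_def star_simps add.commute)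
  have sb: "star b = b" by (simp add: b_def star_simps scaleC_simps)
  have "(2 *\<^sub>R a) * (2 *\<^sub>R a) = (y + star y) * (y + star y)" by (simp add: a_def)
  moreover have "(2 *\<^sub>R b) * (2 *\<^sub>R b) = - ((star y - y) * (star y - y))"
    by (simp add: b_def mult_scaleC_left mult_scaleC_right scaleC_scaleC scaleC_minus_left scaleC_one)
  ultimately have "(2 *\<^sub>R a) * (2 *\<^sub>R a) + (2 *\<^sub>R b) * (2 *\<^sub>R b) = 2 *\<^sub>R (y * star y + star y * y)"
    by (simp add: algebra_simps scaleR_2)
  then have "2 *\<^sub>R (2 *\<^sub>R (a * a + b * b)) = 2 *\<^sub>R (y * star y + star y * y)"
    by (simp add: scaleR_add_right)
  then have eq: "2 *\<^sub>R (a * a + b * b) = y * star y + star y * y"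
    by (metis scaleR_cancel_left zero_neq_numeral)
  have neg: "f (a * a) + f (b * b) \<le> 0" if f: "real_state f" for f
  proof -
    have l: "linear f" using f by (simp add: real_state_def)
    have "2 * (f (a * a) + f (b * b)) = f (y * star y) + f (star y * y)"
      using arg_cong[OF eq, of f] by (simp add: linear_scale[OF l] linear_add[OF l])
    moreover have "f (y * star y) \<le> 0"
      using real_state_nonneg[OF f w] linear_neg[OF l, of "y * star y"] by simp
    moreover have "f (star y * y) \<le> 0"
      using real_state_square_nonneg[OF f sp] by (simp add: yp linear_neg[OF l])
    ultimately show ?thesis by argo
  qed
  obtain f where "real_state f" "f (a * a) = (norm a)\<^sup>2" by (rule exists_norming_real_state[OF sa])
  then have "(norm a)\<^sup>2 \<le> 0" using neg[of f] real_state_square_nonneg[OF _ sb, of f] by linarith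
  then have a0: "a = 0" by simp
  obtain f where "real_state f" "f (b * b) = (norm b)\<^sup>2" by (rule exists_norming_real_state[OF sb])
  then have "(norm b)\<^sup>2 \<le> 0" using neg[of f] real_state_square_nonneg[OF _ sa, of f] by linarith
  then have b0: "b = 0" by simp
  have "y = a + \<i> *\<^sub>C b"
    by (simp add: a_def b_def scaleR_scaleC scaleC_simps flip: scaleC_add_left)
       (simp add: scaleC_one flip: scaleC_add_left)
  then show False using ny a0 b0 by simp
qed

text \<open>
  Kaplansky's argument. For \<open>k = x\<^sup>*x\<close> let \<open>m = |k|\<close> be the square root of \<open>k\<^sup>2\<close>, let \<open>l\<close> be a square
  root of \<open>m\<close>, and let \<open>n = (m - k)/2\<close> be the negative part of \<open>k\<close>. Then \<open>(x n)\<^sup>*(x n) = n k n\<close> is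
  \<open>- (l n)\<^sup>2\<close>, so \<open>x n = 0\<close>. This forces \<open>n = 0\<close>, that is, \<open>k = m = l\<^sup>2\<close>.
\<close>

lemma star_mult_self_eq_square:
  fixes x :: "'a::cstar_algebra"
  obtains h where "star h = h" "star x * x = h * h"
proof -
  have *: "\<exists>h. star h = h \<and> star x * x = h * h" if x: "norm x \<le> 1" for x :: 'a
  proof -
    define k where "k = star x * x"
    have sk: "star k = k" by (simp add: k_def star_simps)
    have nk: "norm k \<le> 1" using x by (simp add: k_def cstar_identity power_le_one)
    obtain m where m: "m * m = k * k" "star m = m" "norm (1 - m) \<le> 1" "k * m = m * k"
    proof (rule exists_sqrt[OF norm_one_minus_square_le[OF sk nk]])
      fix y assume y: "y * y = 1 - (1 - k * k)" "norm (1 - y) \<le> 1"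
        "star (1 - k * k) = 1 - k * k \<Longrightarrow> star y = y"
        "\<And>z. z * (1 - k * k) = (1 - k * k) * z \<Longrightarrow> z * y = y * z"
      have "k * y = y * k" by (rule y(4)) (simp add: algebra_simps)
      then show ?thesis using that[of y] y(1-3) by (simp add: star_simps sk)
    qed
    obtain l where l: "l * l = m" "star l = l" "k * l = l * k" "m * l = l * m"
    proof (rule exists_sqrt[OF m(3)])
      fix y assume y: "y * y = 1 - (1 - m)" "norm (1 - y) \<le> 1"
        "star (1 - m) = 1 - m \<Longrightarrow> star y = y"
        "\<And>z. z * (1 - m) = (1 - m) * z \<Longrightarrow> z * y = y * z"
      have "k * y = y * k" by (rule y(4)) (simp add: algebra_simps m)
      moreover have "m * y = y * m" by (rule y(4)) (simp add: algebra_simps)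
      ultimately show ?thesis using that[of y] y(1-3) by (simp add: star_simps m)
    qed
    define n where "n = (1/2) *\<^sub>R (m - k)"
    have sn: "star n = n" by (simp add: n_def star_simps sk m)
    have kn: "k * n = - (m * n)" by (simp add: n_def algebra_simps m)
    have nm: "n * m = m * n" by (simp add: n_def algebra_simps m)
    have nl: "n * l = l * n" by (simp add: n_def algebra_simps l)
    have "(2 *\<^sub>R n) * (2 *\<^sub>R n) = 2 *\<^sub>R (m * (2 *\<^sub>R n))"
      unfolding n_def by (simp add: algebra_simps m scaleR_2)
    then have nn: "n * n = m * n" by simp
    have "star (x * n) * (x * n) = n * (k * n)"
      by (simp add: star_simps sn k_def mult.assoc)
    also have "\<dots> = - (n * l * (l * n))" by (simp add: kn mult.assoc flip: l(1))
    also have "\<dots> = - ((l * n) * (l * n))" by (simp add: nl)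
    finally have sq: "star (x * n) * (x * n) = - ((l * n) * (l * n))" .
    have "x * n = 0"
      by (rule star_mult_self_eq_minus_square_imp_zero[OF sq]) (simp add: star_simps sn l nl)
    then have "n * (k * n) = 0" by (metis k_def mult.assoc mult_zero_right)
    then have "n * (n * n) = 0" by (simp add: kn nn)
    then have "(n * n) * (n * n) = 0" by (metis mult.assoc mult_zero_left)
    moreover have "star (n * n) = n * n" by (simp add: star_simps sn)
    ultimately have "norm (n * n) = 0"
      using norm_selfadjoint_square[of "n * n"] by simp
    then have "n = 0" using norm_selfadjoint_square[OF sn] by simp
    then have "k = l * l" by (simp add: n_def l)
    then show ?thesis using l k_def by auto
  qed
  show ?thesis
  proof (cases "x = 0")
    case False
    define y where "y = (1 / norm x) *\<^sub>R x"
    have "norm y \<le> 1" using False by (simp add: y_def)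
    then obtain h where h: "star h = h" "star y * y = h * h" using * by blast
    have "x = norm x *\<^sub>R y" using False by (simp add: y_def)
    then have "star x * x = (norm x *\<^sub>R h) * (norm x *\<^sub>R h)"
      using h(2) by (metis mult_scaleR_left mult_scaleR_right star_scaleR)
    then show ?thesis using that[of "norm x *\<^sub>R h"] h(1) by (simp add: star_scaleR)
  qed (use that[of 0] in simp)
qed

text \<open>
  A real state that norms \<open>x\<^sup>*x\<close> is nonnegative at \<open>y\<^sup>*y\<close>.
\<close>

lemma norm_power2_le_norm_sum:
  fixes x y :: "'a::cstar_algebra"
  shows "(norm x)\<^sup>2 \<le> norm (star x * x + star y * y)"
proof -
  obtain h where h: "star h = h" "star x * x = h * h" by (rule star_mult_self_eq_square)
  obtain g where g: "star g = g" "star y * y = g * g" by (rule star_mult_self_eq_square)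
  obtain f where f: "real_state f" "f (h * h) = (norm h)\<^sup>2" by (rule exists_norming_real_state[OF h(1)])
  have "(norm x)\<^sup>2 = f (h * h)"
    using cstar_identity[of x] norm_selfadjoint_square[OF h(1)] by (simp add: h(2) f(2))
  also have "\<dots> \<le> f (h * h) + f (g * g)" using real_state_square_nonneg[OF f(1) g(1)] by simp
  also have "\<dots> = f (star x * x + star y * y)" using f(1) by (simp add: h g real_state_def linear_add)
  also have "\<dots> \<le> norm (star x * x + star y * y)"
    using f(1) unfolding real_state_def by (meson abs_le_D1)
  finally show ?thesis .
qed

section \<open>Automorphisms\<close>

text \<open>
  It suffices to bound the images of self-adjoint contractions, and these are real parts of
  unitaries.
\<close>

lemma star_hom_contractive:
  fixes \<phi> :: "'a::cstar_algebra \<Rightarrow> 'b::cstar_algebra"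
  assumes add: "\<And>x y. \<phi> (x + y) = \<phi> x + \<phi> y" and scale: "\<And>r x. \<phi> (r *\<^sub>R x) = r *\<^sub>R \<phi> x"
    and mult: "\<And>x y. \<phi> (x * y) = \<phi> x * \<phi> y" and st: "\<And>x. \<phi> (star x) = star (\<phi> x)"
    and one: "\<phi> 1 = 1"
  shows "norm (\<phi> x) \<le> norm x"
proof (cases "x = 0")
  case False
  define y where "y = (1 / norm x) *\<^sub>R x"
  have ny: "norm y = 1" using False by (simp add: y_def)
  have sh: "star (star y * y) = star y * y" "norm (star y * y) \<le> 1"
    by (simp_all add: star_simps cstar_identity ny)
  obtain u where u: "star u * u = 1" "star y * y = (1/2) *\<^sub>R (u + star u)"
    using selfadjoint_contraction_unitary[OF sh] by metis
  have "star (\<phi> u) * \<phi> u = 1" using u(1) by (metis mult st one)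
  then have nu: "norm (\<phi> u) \<le> 1" by (rule norm_unitary_le_1)
  have "(norm (\<phi> y))\<^sup>2 = norm (\<phi> (star y * y))" by (simp add: mult st cstar_identity)
  also have "\<dots> = (1/2) * norm (\<phi> u + star (\<phi> u))" by (simp add: u(2) scale add st)
  also have "\<dots> \<le> 1" using norm_triangle_ineq[of "\<phi> u" "star (\<phi> u)"] nu by simp
  finally have "norm (\<phi> y) \<le> 1" using power_le_one_iff[of "norm (\<phi> y)" 2] by simp
  then show ?thesis using False by (simp add: y_def scale field_simps)
qed (use scale[of 0 0] in simp)

lemma star_automorphism_rules:
  assumes "star_automorphism \<phi>"
  shows star_automorphism_add: "\<phi> (x + y) = \<phi> x + \<phi> y"
    and star_automorphism_scaleC: "\<phi> (c *\<^sub>C x) = c *\<^sub>C \<phi> x"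
    and star_automorphism_mult: "\<phi> (x * y) = \<phi> x * \<phi> y"
    and star_automorphism_star: "\<phi> (star x) = star (\<phi> x)"
    and star_automorphism_bij: "bij \<phi>"
    and star_automorphism_one: "\<phi> 1 = 1"
proof -
  show "\<phi> (x + y) = \<phi> x + \<phi> y" "\<phi> (c *\<^sub>C x) = c *\<^sub>C \<phi> x" "\<phi> (star x) = star (\<phi> x)" "bij \<phi>"
    using assms by (simp_all add: star_automorphism_def clinear_iff)
  have mult: "\<phi> (x * y) = \<phi> x * \<phi> y" for x y using assms by (simp add: star_automorphism_def)
  show "\<phi> (x * y) = \<phi> x * \<phi> y" by (rule mult)
  obtain e where "\<phi> e = 1" using assms by (metis star_automorphism_def bij_pointE)
  then show "\<phi> 1 = 1" by (metis mult mult.right_neutral mult_1)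
qed

lemma star_automorphism_norm:
  assumes a: "star_automorphism \<phi>"
  shows "norm (\<phi> x) = norm x"
proof -
  note r = star_automorphism_rules[OF a]
  define \<psi> where "\<psi> = inv \<phi>"
  have inj: "\<phi> u = \<phi> v \<Longrightarrow> u = v" for u v using r(5) by (metis bij_is_inj injD)
  have fp: "\<phi> (\<psi> y) = y" for y by (simp add: \<psi>_def bij_is_surj r(5) surj_f_inv_f)
  have pf: "\<psi> (\<phi> y) = y" for y by (rule inj) (simp add: fp)
  have "norm (\<phi> x) \<le> norm x"
    by (rule star_hom_contractive) (simp_all add: r scaleR_scaleC)
  moreover have "norm (\<psi> (\<phi> x)) \<le> norm (\<phi> x)"
    by (rule star_hom_contractive; rule inj) (simp_all add: fp r scaleR_scaleC)
  ultimately show ?thesis by (simp add: pf)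
qed

lemma star_automorphism_bounded_linear: "star_automorphism \<phi> \<Longrightarrow> bounded_linear \<phi>"
  by (rule bounded_linear_intro[where K=1])
     (simp_all add: star_automorphism_rules star_automorphism_norm scaleR_scaleC)

section \<open>The norm of the crossed product\<close>

lemma module_norm_2:
  fixes v :: "'a::cstar_algebra ^ 2"
  shows "module_norm v = sqrt (norm (star (v $ 1) * v $ 1 + star (v $ 2) * v $ 2))"
  by (simp add: module_norm_def sum_2)

lemma norm_component_le_module_norm:
  fixes v :: "'a::cstar_algebra ^ 2"
  shows "norm (v $ 1) \<le> module_norm v" "norm (v $ 2) \<le> module_norm v"
  using norm_power2_le_norm_sum[of "v $ 1" "v $ 2"] norm_power2_le_norm_sum[of "v $ 2" "v $ 1"]
  by (simp_all add: module_norm_2 real_le_rsqrt add.commute)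

lemma module_norm_le_sum:
  fixes v :: "'a::cstar_algebra ^ 2"
  shows "module_norm v \<le> norm (v $ 1) + norm (v $ 2)"
proof -
  have "norm (star (v $ 1) * v $ 1 + star (v $ 2) * v $ 2) \<le> (norm (v $ 1))\<^sup>2 + (norm (v $ 2))\<^sup>2"
    by (rule norm_triangle_le) (simp add: cstar_identity)
  also have "\<dots> \<le> (norm (v $ 1) + norm (v $ 2))\<^sup>2" by (simp add: power2_sum)
  finally show ?thesis unfolding module_norm_2 by (intro real_le_lsqrt) simp_all
qed

lemma crossed_matrix_vector:
  fixes v :: "'a::cstar_algebra ^ 2"
  shows "(crossed_matrix \<gamma> (a, b) *v v) $ 1 = a * v $ 1 + b * v $ 2"
    and "(crossed_matrix \<gamma> (a, b) *v v) $ 2 = \<gamma> b * v $ 1 + \<gamma> a * v $ 2"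
  by (simp_all add: crossed_matrix_def matrix_vector_mult_def sum_2 vector_2)

text \<open>
  The upper bound on the components of vectors in the unit ball makes the supremum that defines
  the norm finite; the lower bounds come from applying the matrix to the vector \<open>(1, 0)\<close>, whose image
  is \<open>(a, \<gamma> b)\<close>.
\<close>

lemma crossed_norm_bounds:
  assumes \<gamma>: "star_automorphism (\<gamma> :: 'a::cstar_algebra \<Rightarrow> 'a)"
  shows "norm a \<le> Norm (crossed_product \<gamma>) (a, b)"
    and "norm b \<le> Norm (crossed_product \<gamma>) (a, b)"
    and "Norm (crossed_product \<gamma>) (a, b) \<le> 2 * (norm a + norm b)"
proof -
  let ?M = "crossed_matrix \<gamma> (a, b)"
  let ?V = "{v :: 'a^2. module_norm v \<le> 1}"
  have N: "Norm (crossed_product \<gamma>) (a, b) = (SUP v\<in>?V. module_norm (?M *v v))"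
    by (simp add: crossed_product_def matrix_norm_def)
  have ub: "module_norm (?M *v v) \<le> 2 * (norm a + norm b)" if "v \<in> ?V" for v
  proof -
    have v: "norm (v $ 1) \<le> 1" "norm (v $ 2) \<le> 1"
      using norm_component_le_module_norm[of v] that by auto
    have m: "norm (c * v $ 1) \<le> norm c" "norm (c * v $ 2) \<le> norm c" for c
      using v by (auto intro!: order_trans[OF norm_mult_ineq] mult_left_le)
    have "norm (a * v $ 1 + b * v $ 2) \<le> norm a + norm b"
      by (intro norm_triangle_le add_mono m)
    moreover have "norm (\<gamma> b * v $ 1 + \<gamma> a * v $ 2) \<le> norm b + norm a"
      using m[of "\<gamma> b"] m[of "\<gamma> a"]
      by (intro norm_triangle_le add_mono) (simp_all add: star_automorphism_norm[OF \<gamma>])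
    ultimately show ?thesis
      using module_norm_le_sum[of "?M *v v"] by (simp add: crossed_matrix_vector)
  qed
  have bdd: "bdd_above ((\<lambda>v. module_norm (?M *v v)) ` ?V)"
    by (rule bdd_aboveI2[OF ub])
  define e :: "'a^2" where "e = vector [1, 0]"
  have e: "e $ 1 = 1" "e $ 2 = 0" by (simp_all add: e_def vector_2)
  have eV: "e \<in> ?V" by (simp add: module_norm_2 e)
  have le: "module_norm (?M *v e) \<le> Norm (crossed_product \<gamma>) (a, b)"
    unfolding N by (rule cSUP_upper[OF eV bdd])
  show "norm a \<le> Norm (crossed_product \<gamma>) (a, b)" "norm b \<le> Norm (crossed_product \<gamma>) (a, b)"
    using norm_component_le_module_norm[of "?M *v e"] le
    by (simp_all add: crossed_matrix_vector e star_automorphism_norm[OF \<gamma>])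
  show "Norm (crossed_product \<gamma>) (a, b) \<le> 2 * (norm a + norm b)"
    unfolding N using eV ub by (intro cSUP_least) auto
qed

lemma tendsto_crossed_norm_iff:
  assumes \<gamma>: "star_automorphism (\<gamma> :: 'a::cstar_algebra \<Rightarrow> 'a)"
  shows "((\<lambda>h. Norm (crossed_product \<gamma>) (u h, v h)) \<longlongrightarrow> 0) F \<longleftrightarrow>
    ((\<lambda>h. norm (u h)) \<longlongrightarrow> 0) F \<and> ((\<lambda>h. norm (v h)) \<longlongrightarrow> 0) F" (is "?L \<longleftrightarrow> ?R")
proof
  note b = crossed_norm_bounds[OF \<gamma>]
  have nn: "0 \<le> Norm (crossed_product \<gamma>) (x, y)" for x y
    using b(1)[of x y] norm_ge_zero order_trans by blast
  show ?R if ?L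
    using that by (auto intro!: tendsto_sandwich[OF _ _ tendsto_const that] always_eventually b)
  show ?L if ?R
  proof (rule tendsto_sandwich[OF _ _ tendsto_const])
    show "((\<lambda>h. 2 * (norm (u h) + norm (v h))) \<longlongrightarrow> 0) F"
      using that by (intro tendsto_mult_right_zero tendsto_add_zero) auto
  qed (rule always_eventually, rule allI, rule nn b(3))+
qed

section \<open>Entire functions with values in the algebra\<close>

lemma entire_function_algebra_iff:
  "entire_function algebra_structure f \<longleftrightarrow>
     (\<forall>z. \<exists>d. ((\<lambda>h. inverse h *\<^sub>C (f (z + h) - f z)) \<longlongrightarrow> d) (at 0))"
  by (simp add: entire_function_def algebra_structure_def tendsto_norm_zero_iff LIM_zero_iff)

lemma entire_function_crossed_iff:
  assumes "star_automorphism \<gamma>"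
  shows "entire_function (crossed_product \<gamma>) F \<longleftrightarrow>
    entire_function algebra_structure (\<lambda>z. fst (F z)) \<and> entire_function algebra_structure (\<lambda>z. snd (F z))"
proof -
  have eq: "inverse h *\<^sub>C (F (z + h) - F z) - d
      = (inverse h *\<^sub>C (fst (F (z + h)) - fst (F z)) - fst d,
         inverse h *\<^sub>C (snd (F (z + h)) - snd (F z)) - snd d)" for h z d
    by (simp add: scaleC_prod_def prod_eq_iff)
  show ?thesis
    unfolding entire_function_def eq tendsto_crossed_norm_iff[OF assms]
    by (simp add: algebra_structure_def split_paired_Ex all_conj_distrib)
qed

text \<open>
  A complex functional is recovered from its real part \<open>f\<close> as \<open>f(x) - i f(ix)\<close>.
\<close>

lemma exists_separating_functional:
  fixes a :: "'a::cstar_algebra"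
  assumes "a \<noteq> 0"
  obtains \<phi> :: "'a \<Rightarrow> complex" where "bounded_linear \<phi>" "\<And>c x. \<phi> (c *\<^sub>C x) = c * \<phi> x" "\<phi> a \<noteq> 0"
proof -
  obtain f :: "'a \<Rightarrow> real" where f: "linear f" "\<And>x. \<bar>f x\<bar> \<le> norm x" "f a = norm a"
    using exists_norming_functional[of a] by blast
  define \<phi> where "\<phi> x = Complex (f x) (- f (\<i> *\<^sub>C x))" for x
  have f_scaleC: "f (c *\<^sub>C x) = Re c * f x + Im c * f (\<i> *\<^sub>C x)" for c x
  proof -
    have "c *\<^sub>C x = Re c *\<^sub>R x + Im c *\<^sub>R (\<i> *\<^sub>C x)"
      by (simp add: scaleR_scaleC scaleC_scaleC mult.commute flip: scaleC_add_left complex_eq)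
    then show ?thesis by (simp add: linear_add[OF f(1)] linear_scale[OF f(1)])
  qed
  have add: "\<phi> (x + y) = \<phi> x + \<phi> y" for x y
    by (simp add: \<phi>_def scaleC_add_right linear_add[OF f(1)] complex_eq_iff)
  have scale: "\<phi> (c *\<^sub>C x) = c * \<phi> x" for c x
    by (simp add: \<phi>_def complex_eq_iff scaleC_scaleC f_scaleC[of c x] f_scaleC[of "\<i> * c" x])
  have "bounded_linear \<phi>"
  proof (rule bounded_linear_intro[where K=2])
    show "\<phi> (r *\<^sub>R x) = r *\<^sub>R \<phi> x" for r x by (simp add: scaleR_scaleC scale scaleR_conv_of_real)
    show "norm (\<phi> x) \<le> norm x * 2" for x
      using cmod_le[of "\<phi> x"] f(2)[of x] f(2)[of "\<i> *\<^sub>C x"] by (simp add: \<phi>_def norm_scaleC)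
  qed (rule add)
  moreover have "\<phi> a \<noteq> 0" using assms by (simp add: \<phi>_def complex_eq_iff f(3))
  ultimately show ?thesis using that scale by blast
qed

text \<open>
  Composed with a bounded complex functional, \<open>f\<close> becomes a holomorphic function that vanishes on
  the real line, and the functionals separate points.
\<close>

lemma entire_function_zero_on_reals:
  fixes f :: "complex \<Rightarrow> 'a::cstar_algebra"
  assumes f: "entire_function algebra_structure f" and zero: "\<And>t. f (complex_of_real t) = 0"
  shows "f z = 0"
proof (rule ccontr)
  assume "f z \<noteq> 0"
  then obtain \<phi> :: "'a \<Rightarrow> complex" where \<phi>: "bounded_linear \<phi>"
    "\<And>c x. \<phi> (c *\<^sub>C x) = c * \<phi> x" "\<phi> (f z) \<noteq> 0"
    using exists_separating_functional by blast
  interpret \<phi>: bounded_linear \<phi> by (rule \<phi>(1))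
  have "\<exists>D. ((\<lambda>w. \<phi> (f w)) has_field_derivative D) (at w)" for w
  proof -
    obtain d where "((\<lambda>h. inverse h *\<^sub>C (f (w + h) - f w)) \<longlongrightarrow> d) (at 0)"
      using f unfolding entire_function_algebra_iff by blast
    from \<phi>.tendsto[OF this] have "((\<lambda>h. (\<phi> (f (w + h)) - \<phi> (f w)) / h) \<longlongrightarrow> \<phi> d) (at 0)"
      by (simp add: \<phi>(2) \<phi>.diff field_simps)
    then show ?thesis unfolding DERIV_def by blast
  qed
  then have hol: "(\<lambda>w. \<phi> (f w)) holomorphic_on UNIV"
    by (auto simp: holomorphic_on_def field_differentiable_def)
  have "(0::complex) islimpt range complex_of_real"
    unfolding islimpt_approachable
  proof (intro allI impI)
    fix e :: real assume "0 < e"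
    then show "\<exists>x'\<in>range complex_of_real. x' \<noteq> 0 \<and> dist x' 0 < e"
      by (intro bexI[OF _ rangeI[of _ "e/2"]]) (auto simp: norm_divide)
  qed
  then have "\<phi> (f z) = 0"
    by (rule analytic_continuation[OF hol open_UNIV connected_UNIV subset_UNIV UNIV_I])
      (auto simp: zero \<phi>.zero)
  with \<phi>(3) show False by simp
qed

section \<open>The complexified dynamics\<close>

lemma entire_extension_unique:
  fixes \<alpha> :: "real \<Rightarrow> 'a::cstar_algebra \<Rightarrow> 'a"
  assumes f: "entire_extension algebra_structure \<alpha> a f" and g: "entire_extension algebra_structure \<alpha> a g"
  shows "f = g"
proof
  fix z
  have "entire_function algebra_structure (\<lambda>z. f z - g z)"
    unfolding entire_function_algebra_iff
  proof
    fix z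
    obtain d e where "((\<lambda>h. inverse h *\<^sub>C (f (z + h) - f z)) \<longlongrightarrow> d) (at 0)"
      "((\<lambda>h. inverse h *\<^sub>C (g (z + h) - g z)) \<longlongrightarrow> e) (at 0)"
      using f g unfolding entire_extension_def entire_function_algebra_iff by meson
    from tendsto_diff[OF this]
    show "\<exists>d. ((\<lambda>h. inverse h *\<^sub>C (f (z + h) - g (z + h) - (f z - g z))) \<longlongrightarrow> d) (at 0)"
      by (intro exI[of _ "d - e"]) (simp add: scaleC_diff_right scaleC_add_right algebra_simps)
  qed
  moreover have "f (complex_of_real t) - g (complex_of_real t) = 0" for t
    using f g by (simp add: entire_extension_def)
  ultimately have "f z - g z = 0"
    by (rule entire_function_zero_on_reals)
  then show "f z = g z" by simp
qed

lemma complex_dynamics_eq: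
  "entire_extension algebra_structure \<alpha> a f \<Longrightarrow> complex_dynamics algebra_structure \<alpha> z a = f z"
  unfolding complex_dynamics_def by (metis entire_extension_unique the_equality)

lemma entire_extension_crossed_iff:
  assumes "star_automorphism \<gamma>"
  shows "entire_extension (crossed_product \<gamma>) (crossed_dynamics \<alpha>) (a, b) F \<longleftrightarrow>
    entire_extension algebra_structure \<alpha> a (\<lambda>z. fst (F z)) \<and>
    entire_extension algebra_structure \<alpha> b (\<lambda>z. snd (F z))"
  by (auto simp: entire_extension_def entire_function_crossed_iff[OF assms] crossed_dynamics_def
      prod_eq_iff)

lemma analytic_elements_crossed:
  assumes \<gamma>: "star_automorphism \<gamma>"
  shows "(a, b) \<in> analytic_elements (crossed_product \<gamma>) (crossed_dynamics \<alpha>) \<longleftrightarrow>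
    a \<in> analytic_elements algebra_structure \<alpha> \<and> b \<in> analytic_elements algebra_structure \<alpha>"
  (is "?L \<longleftrightarrow> ?R")
proof
  show ?R if ?L
    using that unfolding analytic_elements_def mem_Collect_eq entire_extension_crossed_iff[OF \<gamma>]
    by blast
  show ?L if R: ?R
  proof -
    obtain f g where "entire_extension algebra_structure \<alpha> a f" "entire_extension algebra_structure \<alpha> b g"
      using R unfolding analytic_elements_def by blast
    then have "entire_extension (crossed_product \<gamma>) (crossed_dynamics \<alpha>) (a, b) (\<lambda>z. (f z, g z))"
      by (simp add: entire_extension_crossed_iff[OF \<gamma>])
    then show ?L unfolding analytic_elements_def by blast
  qed
qed

lemma complex_dynamics_crossed:
  assumes \<gamma>: "star_automorphism \<gamma>"
    and a: "a \<in> analytic_elements algebra_structure \<alpha>" and b: "b \<in> analytic_elements algebra_structure \<alpha>"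
  shows "complex_dynamics (crossed_product \<gamma>) (crossed_dynamics \<alpha>) z (a, b)
    = (complex_dynamics algebra_structure \<alpha> z a, complex_dynamics algebra_structure \<alpha> z b)"
proof -
  obtain f g where fg: "entire_extension algebra_structure \<alpha> a f" "entire_extension algebra_structure \<alpha> b g"
    using a b unfolding analytic_elements_def by blast
  have "(THE F. entire_extension (crossed_product \<gamma>) (crossed_dynamics \<alpha>) (a, b) F) = (\<lambda>z. (f z, g z))"
  proof (rule the_equality)
    fix F assume "entire_extension (crossed_product \<gamma>) (crossed_dynamics \<alpha>) (a, b) F"
    then have "(\<lambda>z. fst (F z)) = f" "(\<lambda>z. snd (F z)) = g"
      using fg entire_extension_unique unfolding entire_extension_crossed_iff[OF \<gamma>] by blast+
    then show "F = (\<lambda>z. (f z, g z))" by (auto simp: fun_eq_iff prod_eq_iff)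
  qed (simp add: fg entire_extension_crossed_iff[OF \<gamma>])
  then show ?thesis
    by (simp add: complex_dynamics_def[of "crossed_product \<gamma>"] complex_dynamics_eq[OF fg(1)]
        complex_dynamics_eq[OF fg(2)])
qed

lemma entire_extension_fixed:
  assumes "\<And>t. \<alpha> t a = a"
  shows "entire_extension algebra_structure \<alpha> a (\<lambda>_. a)"
  using assms by (auto simp: entire_extension_def entire_function_algebra_iff)

lemma entire_extension_automorphism:
  assumes \<phi>: "star_automorphism \<phi>" and comm: "\<And>t x. \<alpha> t (\<phi> x) = \<phi> (\<alpha> t x)"
    and f: "entire_extension algebra_structure \<alpha> a f"
  shows "entire_extension algebra_structure \<alpha> (\<phi> a) (\<lambda>z. \<phi> (f z))"
  unfolding entire_extension_def entire_function_algebra_iff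
proof (intro conjI allI)
  interpret \<phi>: bounded_linear \<phi> by (rule star_automorphism_bounded_linear[OF \<phi>])
  fix z
  obtain d where "((\<lambda>h. inverse h *\<^sub>C (f (z + h) - f z)) \<longlongrightarrow> d) (at 0)"
    using f unfolding entire_extension_def entire_function_algebra_iff by blast
  from \<phi>.tendsto[OF this]
  show "\<exists>d. ((\<lambda>h. inverse h *\<^sub>C (\<phi> (f (z + h)) - \<phi> (f z))) \<longlongrightarrow> d) (at 0)"
    by (auto simp: star_automorphism_scaleC[OF \<phi>] \<phi>.diff)
qed (use f comm in \<open>simp add: entire_extension_def\<close>)

context graded_cstar_dynamical_system
begin

lemma dynamics_grading_apply: "\<alpha> t (\<gamma> x) = \<gamma> (\<alpha> t x)"
  using dynamics_grading[of t] by (simp add: fun_eq_iff)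

lemma grading_grading: "\<gamma> (\<gamma> x) = x"
  using grading_involutive by (simp add: fun_eq_iff)

lemma zero_analytic: "0 \<in> analytic_elements algebra_structure \<alpha>"
  and complex_dynamics_zero: "complex_dynamics algebra_structure \<alpha> z 0 = 0"
proof -
  have "\<alpha> t 0 = 0" for t
    using star_automorphism_add[OF automorphism_dynamics, of t 0 0] by simp
  note e = entire_extension_fixed[of \<alpha>, OF this]
  show "0 \<in> analytic_elements algebra_structure \<alpha>" using e unfolding analytic_elements_def by blast
  show "complex_dynamics algebra_structure \<alpha> z 0 = 0" using complex_dynamics_eq[OF e] .
qed

lemma one_analytic: "1 \<in> analytic_elements algebra_structure \<alpha>"
  and complex_dynamics_one: "complex_dynamics algebra_structure \<alpha> z 1 = 1"
proof -
  note e = entire_extension_fixed[of \<alpha>, OF star_automorphism_one[OF automorphism_dynamics]]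
  show "1 \<in> analytic_elements algebra_structure \<alpha>" using e unfolding analytic_elements_def by blast
  show "complex_dynamics algebra_structure \<alpha> z 1 = 1" using complex_dynamics_eq[OF e] .
qed

lemma grading_analytic:
  assumes "a \<in> analytic_elements algebra_structure \<alpha>"
  shows "\<gamma> a \<in> analytic_elements algebra_structure \<alpha>"
    and "complex_dynamics algebra_structure \<alpha> z (\<gamma> a) = \<gamma> (complex_dynamics algebra_structure \<alpha> z a)"
proof -
  obtain f where f: "entire_extension algebra_structure \<alpha> a f"
    using assms unfolding analytic_elements_def by blast
  note e = entire_extension_automorphism[OF automorphism_grading dynamics_grading_apply f]
  show "\<gamma> a \<in> analytic_elements algebra_structure \<alpha>" using e unfolding analytic_elements_def by blast
  show "complex_dynamics algebra_structure \<alpha> z (\<gamma> a) = \<gamma> (complex_dynamics algebra_structure \<alpha> z a)"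
    by (simp add: complex_dynamics_eq[OF e] complex_dynamics_eq[OF f])
qed

end

section \<open>Density of the analytic elements\<close>

text \<open>
  The values lie in an arbitrary Banach space, possibly a nonseparable one, so the integrals
  are gauge integrals and domination is reduced to the Cauchy criterion: beyond \<open>[-B, B]\<close> the
  integral of \<open>f\<close> is bounded by that of \<open>h\<close>.
\<close>

lemma integrable_on_UNIV_dominated:
  fixes f :: "real \<Rightarrow> 'b::banach"
  assumes f: "continuous_on UNIV f" and h: "h integrable_on UNIV"
    and le: "\<And>t. norm (f t) \<le> h t"
  shows "f integrable_on UNIV"
  unfolding integrable_alt[of f UNIV]
proof (intro conjI allI impI)
  have fi: "f integrable_on {a..b}" for a b
    by (rule integrable_continuous_real) (rule continuous_on_subset[OF f subset_UNIV])
  then show "(\<lambda>x. if x \<in> UNIV then f x else 0) integrable_on cbox a b" for a b by simp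
  have hi: "h integrable_on {a..b}" for a b
    by (rule integrable_on_subinterval[OF h subset_UNIV])
  fix e :: real assume "0 < e"
  then have "\<exists>B>0. \<forall>a b c d. ball 0 B \<subseteq> cbox a b \<and> ball 0 B \<subseteq> cbox c d \<longrightarrow>
      norm (integral (cbox a b) h - integral (cbox c d) h) < e/2"
    using conjunct2[OF iffD1[OF integrable_alt h], rule_format, of "e/2"] by simp
  then obtain B where B: "0 < B" and B': "\<And>a b c d. ball 0 B \<subseteq> cbox a b \<Longrightarrow> ball 0 B \<subseteq> cbox c d \<Longrightarrow>
      norm (integral (cbox a b) h - integral (cbox c d) h) < e/2"
    by blast
  have sub: "a \<le> - B \<and> B \<le> b" if "ball 0 B \<subseteq> cbox a b" for a b
  proof -
    have "closure (ball 0 B) \<subseteq> cbox a b" using that by (intro closure_minimal) auto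
    then have "cball 0 B \<subseteq> cbox a b" using B by simp
    moreover have "- B \<in> cball 0 B" "B \<in> cball 0 B" using B by simp_all
    ultimately have "- B \<in> cbox a b" "B \<in> cbox a b" by blast+
    then show ?thesis by simp
  qed
  have half: "norm (integral (cbox a b) f - integral {-B..B} f) < e/2" if ab: "ball 0 B \<subseteq> cbox a b" for a b
  proof -
    have s: "a \<le> - B" "B \<le> b" using sub[OF ab] by auto
    have split: "integral {a..b} k - integral {-B..B} k = integral {a..-B} k + integral {B..b} k"
      if k: "\<And>a b. k integrable_on {a..b}" for k :: "real \<Rightarrow> 'c::banach"
    proof -
      have "integral {a..b} k = integral {a..-B} k + integral {-B..b} k"
        "integral {-B..b} k = integral {-B..B} k + integral {B..b} k"
        using s B k by (simp_all add: Henstock_Kurzweil_Integration.integral_combine)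
      then show ?thesis by simp
    qed
    have "norm (integral {a..b} f - integral {-B..B} f)
        \<le> norm (integral {a..-B} f) + norm (integral {B..b} f)"
      unfolding split[OF fi] by (rule norm_triangle_ineq)
    also have "\<dots> \<le> integral {a..-B} h + integral {B..b} h"
      by (intro add_mono integral_norm_bound_integral fi hi le)
    also have "\<dots> = integral {a..b} h - integral {-B..B} h" by (rule split[OF hi, symmetric])
    also have "\<dots> < e/2"
    proof -
      have "ball 0 B \<subseteq> cbox (- B) B" by (auto simp: dist_real_def)
      from B'[OF ab this] show ?thesis by (simp del: less_divide_eq_numeral1)
    qed
    finally show ?thesis by simp
  qed
  show "\<exists>B>0. \<forall>a b c d. ball 0 B \<subseteq> cbox a b \<and> ball 0 B \<subseteq> cbox c d \<longrightarrow>
      norm (integral (cbox a b) (\<lambda>x. if x \<in> UNIV then f x else 0) -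
        integral (cbox c d) (\<lambda>x. if x \<in> UNIV then f x else 0)) < e"
  proof (intro exI[of _ B] conjI B allI impI, elim conjE)
    fix a b c d :: real assume "ball 0 B \<subseteq> cbox a b" "ball 0 B \<subseteq> cbox c d"
    from half[OF this(1)] half[OF this(2)]
    have "dist (integral (cbox a b) f) (integral (cbox c d) f) < e"
      unfolding dist_norm[symmetric] by (rule dist_triangle_half_l)
    then show "norm (integral (cbox a b) (\<lambda>x. if x \<in> UNIV then f x else 0) -
        integral (cbox c d) (\<lambda>x. if x \<in> UNIV then f x else 0)) < e" by (simp add: dist_norm)
  qed
qed

lemma has_integral_translate_UNIV:
  fixes f :: "real \<Rightarrow> 'b::banach"
  assumes "(f has_integral I) UNIV"
  shows "((\<lambda>t. f (c + t)) has_integral I) UNIV"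
proof -
  have f: "f integrable_on cbox a b" for a b
    using assms unfolding has_integral_alt'[of f] by simp
  have lim: "\<exists>B>0. \<forall>a b. ball 0 B \<subseteq> cbox a b \<longrightarrow> norm (integral (cbox a b) f - I) < e" if "0 < e" for e
    using assms that unfolding has_integral_alt'[of f] by simp
  have "(f \<circ> (+) c has_integral I) UNIV"
    unfolding has_integral_alt'[of "f \<circ> (+) c"]
  proof (intro conjI allI impI)
    show "(\<lambda>x. if x \<in> UNIV then (f \<circ> (+) c) x else 0) integrable_on cbox a b" for a b
      using f integrable_on_shift_cbox[of f c a b] by (simp add: o_def)
    fix e :: real assume "0 < e"
    then obtain B where B: "0 < B" "\<And>a b. ball 0 B \<subseteq> cbox a b \<Longrightarrow> norm (integral (cbox a b) f - I) < e"
      using lim by blast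
    have "norm (integral (cbox a b) (f \<circ> (+) c) - I) < e" if ab: "ball 0 (B + \<bar>c\<bar>) \<subseteq> cbox a b" for a b
    proof -
      have "ball 0 B \<subseteq> cbox (a + c) (b + c)"
      proof
        fix x :: real assume "x \<in> ball 0 B"
        then have "x - c \<in> ball 0 (B + \<bar>c\<bar>)" by (auto simp: dist_real_def)
        then have "x - c \<in> cbox a b" using ab by blast
        then show "x \<in> cbox (a + c) (b + c)" by (simp add: algebra_simps)
      qed
      then show ?thesis using B(2) integral_shift_cbox_plus[of a b f c] by simp
    qed
    then show "\<exists>B>0. \<forall>a b. ball 0 B \<subseteq> cbox a b \<longrightarrow>
        norm (integral (cbox a b) (\<lambda>x. if x \<in> UNIV then (f \<circ> (+) c) x else 0) - I) < e"
      using B(1) by (intro exI[of _ "B + \<bar>c\<bar>"]) (simp add: o_def)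
  qed
  then show ?thesis by (simp add: o_def)
qed

lemma integrable_inverse_1_plus_square_UNIV:
  "(\<lambda>t::real. 1 / (1 + t\<^sup>2)) integrable_on UNIV"
proof -
  have "integrable lborel (\<lambda>t::real. 1 / (1 + t\<^sup>2))"
    using integrable_inverse_1_plus_square by (simp add: set_integrable_def inverse_eq_divide)
  from has_integral_integral_real[OF this] show ?thesis by blast
qed

lemma kernel_integral:
  fixes g :: "real \<Rightarrow> 'a::cstar_algebra"
  assumes k: "continuous_on UNIV k" and kC: "\<And>t. cmod (k t) \<le> C / (1 + t\<^sup>2)"
    and g: "continuous_on UNIV g" and gM: "\<And>t. norm (g t) \<le> M"
  shows "(\<lambda>t. k t *\<^sub>C g t) integrable_on UNIV"
    and "norm (integral UNIV (\<lambda>t. k t *\<^sub>C g t)) \<le> C * M * integral UNIV (\<lambda>t::real. 1 / (1 + t\<^sup>2))"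
proof -
  have bd: "norm (k t *\<^sub>C g t) \<le> C * M * (1 / (1 + t\<^sup>2))" for t
  proof -
    have "norm (k t *\<^sub>C g t) \<le> (C / (1 + t\<^sup>2)) * M"
      unfolding norm_scaleC using kC[of t] gM[of t]
      by (intro mult_mono) (auto intro: order_trans[OF norm_ge_zero])
    then show ?thesis by simp
  qed
  have h: "(\<lambda>t::real. C * M * (1 / (1 + t\<^sup>2))) integrable_on UNIV"
    by (rule integrable_on_mult_right[OF integrable_inverse_1_plus_square_UNIV])
  have c: "continuous_on UNIV (\<lambda>t. k t *\<^sub>C g t)"
    by (rule bounded_bilinear.continuous_on[OF bounded_bilinear_scaleC k g])
  show i: "(\<lambda>t. k t *\<^sub>C g t) integrable_on UNIV"
    by (rule integrable_on_UNIV_dominated[OF c h bd])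
  show "norm (integral UNIV (\<lambda>t. k t *\<^sub>C g t)) \<le> C * M * integral UNIV (\<lambda>t::real. 1 / (1 + t\<^sup>2))"
    using integral_norm_bound_integral[OF i h bd] by (simp only: integral_mult_right)
qed

definition gaussian_kernel :: "real \<Rightarrow> real \<Rightarrow> complex \<Rightarrow> complex" where
  "gaussian_kernel n t w = exp (- of_real n * (of_real t - w)\<^sup>2)"

text \<open>
  With \<open>u = t - Re w\<close> the kernel is at most \<open>exp(- u\<^sup>2) exp(n R\<^sup>2)\<close> in absolute value, while \<open>1 + t\<^sup>2\<close>
  and \<open>1 + |t - w|\<^sup>2\<close> are each at most a constant times \<open>1 + u\<^sup>2\<close>; finally \<open>(1 + u\<^sup>2)\<^sup>2 \<le> 4 exp(u\<^sup>2)\<close>. The left factor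
  \<open>1 + |t - w|\<^sup>2\<close> lets the same bound serve for the first two derivatives in \<open>w\<close>.
\<close>

lemma gaussian_kernel_bound:
  assumes n: "1 \<le> n" and w: "cmod w \<le> R"
  shows "(1 + (cmod (of_real t - w))\<^sup>2) * cmod (gaussian_kernel n t w)
    \<le> 8 * (1 + R\<^sup>2)\<^sup>2 * exp (n * R\<^sup>2) / (1 + t\<^sup>2)"
proof -
  define u y where "u = t - Re w" and "y = Im w"
  have R2: "(Re w)\<^sup>2 \<le> R\<^sup>2" "y\<^sup>2 \<le> R\<^sup>2"
    using abs_Re_le_cmod[of w] abs_Im_le_cmod[of w] w unfolding y_def
    by (metis abs_ge_zero order_trans power2_abs power_mono)+
  have "t\<^sup>2 = (u + Re w)\<^sup>2" by (simp add: u_def)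
  also have "\<dots> \<le> 2 * u\<^sup>2 + 2 * (Re w)\<^sup>2"
    using zero_le_power2[of "u - Re w"] by (simp add: power2_sum power2_diff)
  also have "\<dots> \<le> 2 * u\<^sup>2 + 2 * R\<^sup>2" using R2 by simp
  finally have "1 + t\<^sup>2 \<le> 2 * (1 + u\<^sup>2 + R\<^sup>2 + u\<^sup>2 * R\<^sup>2)" by (simp add: add_increasing2)
  then have "1 + t\<^sup>2 \<le> 2 * ((1 + u\<^sup>2) * (1 + R\<^sup>2))" by (simp add: algebra_simps)
  moreover have "1 + (cmod (of_real t - w))\<^sup>2 \<le> (1 + u\<^sup>2) * (1 + R\<^sup>2)"
  proof -
    have "1 + (cmod (of_real t - w))\<^sup>2 = 1 + u\<^sup>2 + y\<^sup>2" by (simp add: cmod_power2 u_def y_def)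
    also have "\<dots> \<le> 1 + u\<^sup>2 + R\<^sup>2 + u\<^sup>2 * R\<^sup>2" using R2 by (simp add: add_increasing2)
    finally show ?thesis by (simp add: algebra_simps)
  qed
  moreover have "cmod (gaussian_kernel n t w) \<le> exp (- (u\<^sup>2)) * exp (n * R\<^sup>2)"
  proof -
    have "Re (- of_real n * (of_real t - w)\<^sup>2) = - n * (u\<^sup>2 - y\<^sup>2)"
      by (simp add: Re_power2 u_def y_def)
    also have "\<dots> \<le> - (u\<^sup>2) + n * R\<^sup>2"
    proof -
      have "n * y\<^sup>2 \<le> n * R\<^sup>2" using R2 n by (intro mult_left_mono) auto
      moreover have "1 * u\<^sup>2 \<le> n * u\<^sup>2" using n by (intro mult_right_mono) auto
      ultimately show ?thesis by (simp add: algebra_simps)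
    qed
    finally show ?thesis by (simp add: gaussian_kernel_def flip: exp_add)
  qed
  ultimately have "(1 + t\<^sup>2) * ((1 + (cmod (of_real t - w))\<^sup>2) * cmod (gaussian_kernel n t w))
      \<le> (2 * ((1 + u\<^sup>2) * (1 + R\<^sup>2))) * (((1 + u\<^sup>2) * (1 + R\<^sup>2)) * (exp (- (u\<^sup>2)) * exp (n * R\<^sup>2)))"
    by (intro mult_mono) auto
  also have "\<dots> = 2 * (1 + R\<^sup>2)\<^sup>2 * exp (n * R\<^sup>2) * ((1 + u\<^sup>2)\<^sup>2 * exp (- (u\<^sup>2)))"
    by (simp add: power2_eq_square)
  also have "\<dots> \<le> 2 * (1 + R\<^sup>2)\<^sup>2 * exp (n * R\<^sup>2) * 4"
  proof (intro mult_left_mono)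
    have "1 + u\<^sup>2 \<le> 2 * exp (u\<^sup>2 / 2)" using exp_ge_add_one_self[of "u\<^sup>2 / 2"] by linarith
    then have "(1 + u\<^sup>2)\<^sup>2 \<le> (2 * exp (u\<^sup>2 / 2))\<^sup>2" by (intro power_mono) auto
    also have "\<dots> = 4 * exp (u\<^sup>2)" by (simp add: power_mult_distrib flip: exp_double)
    finally show "(1 + u\<^sup>2)\<^sup>2 * exp (- (u\<^sup>2)) \<le> 4"
      by (simp add: exp_minus pos_divide_le_eq flip: divide_inverse)
  qed auto
  finally show ?thesis
    by (subst pos_le_divide_eq) (auto simp: add_pos_nonneg mult.commute)
qed

text \<open>
  By Taylor's formula the difference quotient of the kernel differs from its derivative by at most
  \<open>|h|\<close> times a bound for the second derivative on the unit ball around \<open>z\<close>. That bound is integrable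
  in \<open>t\<close>, so the difference quotient of the integral converges.
\<close>

lemma gaussian_transform_entire:
  fixes g :: "real \<Rightarrow> 'a::cstar_algebra"
  assumes n: "1 \<le> n" and g: "continuous_on UNIV g" and gM: "\<And>t. norm (g t) \<le> M"
  shows "\<And>z. (\<lambda>t. gaussian_kernel n t z *\<^sub>C g t) integrable_on UNIV"
    and "entire_function algebra_structure (\<lambda>z. integral UNIV (\<lambda>t. gaussian_kernel n t z *\<^sub>C g t))"
proof -
  define k0 where "k0 t w = gaussian_kernel n t w" for t w
  define k1 where "k1 t w = 2 * of_real n * (of_real t - w) * gaussian_kernel n t w" for t w
  define k2 where "k2 t w = (4 * (of_real n)\<^sup>2 * (of_real t - w)\<^sup>2 - 2 * of_real n) * gaussian_kernel n t w"
    for t w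
  \<comment> \<open>The factor \<open>P (1 + |t - w|\<^sup>2)\<close> dominates the polynomial factors of the kernel and of its first
    two derivatives.\<close>
  define P where "P = 4 * n\<^sup>2 + 2 * n"
  define B where "B R = P * (8 * (1 + R\<^sup>2)\<^sup>2 * exp (n * R\<^sup>2))" for R
  define J where "J = integral UNIV (\<lambda>t::real. 1 / (1 + t\<^sup>2))"
  have n2: "1 \<le> n\<^sup>2" using n by (simp add: one_le_power)
  have P: "1 \<le> P" "0 \<le> P" using n n2 unfolding P_def by linarith+
  have d0: "(k0 t has_field_derivative k1 t w) (at w within S)" for t w S
    unfolding k0_def k1_def gaussian_kernel_def
    by (rule derivative_eq_intros refl)+ (simp add: algebra_simps power2_eq_square)
  have d1: "(k1 t has_field_derivative k2 t w) (at w within S)" for t w S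
    unfolding k1_def k2_def gaussian_kernel_def
    by (rule derivative_eq_intros refl)+ (simp add: algebra_simps power2_eq_square)
  have P_bound: "P * (1 + (cmod (of_real t - w))\<^sup>2) * cmod (gaussian_kernel n t w) \<le> B R / (1 + t\<^sup>2)"
    if "cmod w \<le> R" for t w R
    using mult_left_mono[OF gaussian_kernel_bound[OF n that, of t] P(2)]
    by (simp add: B_def mult.assoc)
  have b0: "cmod (k0 t w) \<le> B R / (1 + t\<^sup>2)" if w: "cmod w \<le> R" for t w R
  proof (rule order_trans[OF _ P_bound[OF w]])
    have "1 * 1 \<le> P * (1 + (cmod (of_real t - w))\<^sup>2)" using P by (intro mult_mono) auto
    then show "cmod (k0 t w) \<le> P * (1 + (cmod (of_real t - w))\<^sup>2) * cmod (gaussian_kernel n t w)"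
      using mult_right_mono[OF _ norm_ge_zero[of "gaussian_kernel n t w"]] by (fastforce simp: k0_def)
  qed
  have b1: "cmod (k1 t w) \<le> B R / (1 + t\<^sup>2)" if w: "cmod w \<le> R" for t w R
  proof (rule order_trans[OF _ P_bound[OF w]])
    have "cmod (of_real t - w) \<le> 1 + (cmod (of_real t - w))\<^sup>2"
    proof -
      have "2 * cmod (of_real t - w) \<le> 1 + (cmod (of_real t - w))\<^sup>2"
        using zero_le_power2[of "cmod (of_real t - w) - 1"] by (simp add: power2_diff)
      with norm_ge_zero[of "of_real t - w"] show ?thesis by linarith
    qed
    then have "2 * n * cmod (of_real t - w) \<le> P * (1 + (cmod (of_real t - w))\<^sup>2)"
      using n n2 by (intro mult_mono) (auto simp: P_def)
    then show "cmod (k1 t w) \<le> P * (1 + (cmod (of_real t - w))\<^sup>2) * cmod (gaussian_kernel n t w)"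
      using n unfolding k1_def norm_mult by (intro mult_right_mono) auto
  qed
  have b2: "cmod (k2 t w) \<le> B R / (1 + t\<^sup>2)" if w: "cmod w \<le> R" for t w R
  proof (rule order_trans[OF _ P_bound[OF w]])
    have "cmod (4 * (of_real n)\<^sup>2 * (of_real t - w)\<^sup>2 - 2 * of_real n)
        \<le> 4 * n\<^sup>2 * (cmod (of_real t - w))\<^sup>2 + 2 * n"
      using n by (intro order_trans[OF norm_triangle_ineq4]) (simp add: norm_mult norm_power)
    also have "\<dots> \<le> P * (1 + (cmod (of_real t - w))\<^sup>2)"
      using n by (simp add: P_def algebra_simps)
    finally show "cmod (k2 t w) \<le> P * (1 + (cmod (of_real t - w))\<^sup>2) * cmod (gaussian_kernel n t w)"
      unfolding k2_def norm_mult by (intro mult_right_mono) auto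
  qed
  have c0: "continuous_on UNIV (\<lambda>t. k0 t w)" and c1: "continuous_on UNIV (\<lambda>t. k1 t w)" for w
    unfolding k0_def k1_def gaussian_kernel_def by (intro continuous_intros)+
  have i0: "(\<lambda>t. k0 t w *\<^sub>C g t) integrable_on UNIV" and i1: "(\<lambda>t. k1 t w *\<^sub>C g t) integrable_on UNIV" for w
    using kernel_integral(1)[OF c0 b0 g gM] kernel_integral(1)[OF c1 b1 g gM] by auto
  show "(\<lambda>t. gaussian_kernel n t z *\<^sub>C g t) integrable_on UNIV" for z
    using i0[of z] by (simp add: k0_def)
  show "entire_function algebra_structure (\<lambda>z. integral UNIV (\<lambda>t. gaussian_kernel n t z *\<^sub>C g t))"
    unfolding entire_function_algebra_iff
  proof
    fix z
    define G where "G w = integral UNIV (\<lambda>t. k0 t w *\<^sub>C g t)" for w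
    define G' where "G' = integral UNIV (\<lambda>t. k1 t z *\<^sub>C g t)"
    define R where "R = cmod z + 1"
    have est: "norm (inverse h *\<^sub>C (G (z + h) - G z) - G') \<le> cmod h * (B R * M * J)"
      if h: "h \<noteq> 0" "cmod h \<le> 1" for h
    proof -
      define r where "r t = k0 t (z + h) - k0 t z - h * k1 t z" for t
      have rb: "cmod (r t) \<le> (B R * (cmod h)\<^sup>2) / (1 + t\<^sup>2)" for t
      proof -
        let ?f = "\<lambda>i::nat. if i = 0 then k0 t else if i = 1 then k1 t else k2 t"
        have "cmod (?f 0 (z + h) - (\<Sum>i\<le>1. ?f i z * ((z + h) - z) ^ i / fact i))
            \<le> (B R / (1 + t\<^sup>2)) * cmod ((z + h) - z) ^ Suc 1 / fact 1"
        proof (rule complex_Taylor[of "cball z 1"])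
          fix x assume "x \<in> cball z 1"
          then have "cmod x \<le> R"
            using norm_triangle_sub[of x z] by (simp add: R_def dist_norm norm_minus_commute)
          then show "cmod (?f (Suc 1) x) \<le> B R / (1 + t\<^sup>2)" using b2 by simp
        qed (use h d0 d1 in \<open>auto simp: le_Suc_eq dist_norm\<close>)
        then show ?thesis by (simp add: r_def power2_eq_square algebra_simps)
      qed
      have rc: "continuous_on UNIV r"
        unfolding r_def by (intro continuous_intros c0 c1)
      have "integral UNIV (\<lambda>t. r t *\<^sub>C g t)
          = integral UNIV (\<lambda>t. (k0 t (z + h) *\<^sub>C g t - k0 t z *\<^sub>C g t) - h *\<^sub>C (k1 t z *\<^sub>C g t))"
        by (simp add: r_def scaleC_simps)
      also have "\<dots> = (G (z + h) - G z) - integral UNIV (\<lambda>t. h *\<^sub>C (k1 t z *\<^sub>C g t))"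
        unfolding G_def using i0 i1 integrable_linear[OF i1 bounded_linear_scaleC[of h]]
        by (subst integral_diff) (auto simp: o_def integral_diff intro: integrable_diff)
      also have "integral UNIV (\<lambda>t. h *\<^sub>C (k1 t z *\<^sub>C g t)) = h *\<^sub>C G'"
        using integral_linear[OF i1 bounded_linear_scaleC[of h]] by (simp add: o_def G'_def)
      finally have eq: "G (z + h) - G z - h *\<^sub>C G' = integral UNIV (\<lambda>t. r t *\<^sub>C g t)" by simp
      have "inverse h *\<^sub>C (G (z + h) - G z) - G' = inverse h *\<^sub>C (G (z + h) - G z - h *\<^sub>C G')"
        using h by (simp add: scaleC_simps scaleC_one)
      then have "norm (inverse h *\<^sub>C (G (z + h) - G z) - G')
          = inverse (cmod h) * norm (integral UNIV (\<lambda>t. r t *\<^sub>C g t))"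
        by (simp add: eq norm_scaleC norm_inverse)
      also have "\<dots> \<le> inverse (cmod h) * ((B R * (cmod h)\<^sup>2) * M * J)"
        using kernel_integral(2)[OF rc rb g gM] by (intro mult_left_mono) (auto simp: J_def)
      also have "\<dots> = cmod h * (B R * M * J)" using h by (simp add: power2_eq_square)
      finally show ?thesis .
    qed
    have "((\<lambda>h. inverse h *\<^sub>C (G (z + h) - G z) - G') \<longlongrightarrow> 0) (at 0)"
    proof (rule Lim_null_comparison)
      show "\<forall>\<^sub>F h in at 0. norm (inverse h *\<^sub>C (G (z + h) - G z) - G') \<le> cmod h * (B R * M * J)"
        unfolding eventually_at by (intro exI[of _ 1]) (auto intro!: est)
      show "((\<lambda>h::complex. cmod h * (B R * M * J)) \<longlongrightarrow> 0) (at 0)"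
        by (auto intro!: tendsto_eq_intros)
    qed
    then show "\<exists>d. ((\<lambda>h. inverse h *\<^sub>C (integral UNIV (\<lambda>t. gaussian_kernel n t (z + h) *\<^sub>C g t)
        - integral UNIV (\<lambda>t. gaussian_kernel n t z *\<^sub>C g t))) \<longlongrightarrow> d) (at 0)"
      by (auto simp: G_def k0_def LIM_zero_iff)
  qed
qed

context graded_cstar_dynamical_system
begin

lemma dynamics_bounded_linear: "bounded_linear (\<alpha> t)"
  by (rule star_automorphism_bounded_linear[OF automorphism_dynamics])

lemma norm_dynamics: "norm (\<alpha> t a) = norm a"
  by (rule star_automorphism_norm[OF automorphism_dynamics])

text \<open>
  At a real argument \<open>s\<close> the transform is \<open>\<alpha>\<^sub>s\<close> of its value at 0, since the kernel depends on \<open>t - z\<close>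
  only and the integral is translation invariant.
\<close>

lemma gaussian_smoothing_entire_extension:
  fixes a :: 'a
  assumes n: "1 \<le> n"
  defines "G \<equiv> \<lambda>z. integral UNIV (\<lambda>t. gaussian_kernel n t z *\<^sub>C \<alpha> t a)"
  shows "entire_extension algebra_structure \<alpha> (G 0) G"
  unfolding entire_extension_def
proof (intro conjI allI)
  note tr = gaussian_transform_entire[OF n strongly_continuous[of a] eq_refl[OF norm_dynamics[of _ a]]]
  show "entire_function algebra_structure G" unfolding G_def by (rule tr(2))
  fix s
  have "\<alpha> s (G 0) = integral UNIV (\<lambda>t. \<alpha> s (gaussian_kernel n t 0 *\<^sub>C \<alpha> t a))"
    using integral_linear[OF tr(1)[of 0] dynamics_bounded_linear[of s]] by (simp add: G_def o_def)
  also have "(\<lambda>t. \<alpha> s (gaussian_kernel n t 0 *\<^sub>C \<alpha> t a))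
      = (\<lambda>t. gaussian_kernel n (s + t) (of_real s) *\<^sub>C \<alpha> (s + t) a)"
    by (simp add: star_automorphism_scaleC[OF automorphism_dynamics] dynamics_add gaussian_kernel_def)
  also have "integral UNIV \<dots> = G (of_real s)"
    unfolding G_def
    using has_integral_translate_UNIV[OF integrable_integral[OF tr(1)[of "of_real s"]], of s]
    by (rule integral_unique)
  finally show "G (complex_of_real s) = \<alpha> s (G 0)" by simp
qed

text \<open>
  The normal distribution with small variance \<open>\<sigma>\<^sup>2\<close> is an approximate identity. The quantitative
  form used here is \<open>\<parallel>\<alpha>\<^sub>t(a) - a\<parallel> \<le> e/2 + D t\<^sup>2\<close> with a constant \<open>D\<close>, which averages to \<open>e/2 + D \<sigma>\<^sup>2\<close>.
\<close>

lemma analytic_elements_dense: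
  assumes e: "0 < e"
  obtains b where "b \<in> analytic_elements algebra_structure \<alpha>" "norm (b - a) < e"
proof -
  have "isCont (\<lambda>t. \<alpha> t a) 0"
    using strongly_continuous[of a] by (simp add: continuous_on_eq_continuous_at)
  then have "\<exists>\<delta>>0. \<forall>t. \<bar>t\<bar> < \<delta> \<longrightarrow> norm (\<alpha> t a - a) < e/2"
    using half_gt_zero[OF e] unfolding continuous_at_eps_delta dist_norm
    by (simp only: diff_zero real_norm_def dynamics_zero id_apply)
  then obtain \<delta> where \<delta>: "0 < \<delta>" "\<And>t. \<bar>t\<bar> < \<delta> \<Longrightarrow> norm (\<alpha> t a - a) < e/2"
    by blast
  \<comment> \<open>For \<open>|t| \<ge> \<delta>\<close> this constant gives \<open>D t\<^sup>2 \<ge> 2 \<parallel>a\<parallel>\<close>.\<close>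
  define D where "D = 2 * norm a / \<delta>\<^sup>2"
  define n where "n = max 1 (D / e + 1)"
  have n: "1 \<le> n" "0 < n" "D / e < n" by (auto simp: n_def)
  define \<sigma> where "\<sigma> = sqrt (1 / (2 * n))"
  have \<sigma>: "0 < \<sigma>" "\<sigma>\<^sup>2 = 1 / (2 * n)" using n by (simp_all add: \<sigma>_def)
  let ?w = "normal_density 0 \<sigma>"
  have w0: "(?w has_integral 1) UNIV"
    using has_integral_integral_real[OF integrable_normal_density[OF \<sigma>(1), of 0]] \<sigma>
    by (simp add: integral_normal_density)
  have w2: "((\<lambda>t. ?w t * t\<^sup>2) has_integral \<sigma>\<^sup>2) UNIV"
    using has_integral_integral_real[OF integrable_normal_moment[OF \<sigma>(1), of 0 2]]
      integral_normal_moment_even[OF \<sigma>(1), of 0 1] by (simp add: fact_numeral)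
  have close: "norm (\<alpha> t a - a) \<le> e/2 + D * t\<^sup>2" for t
  proof (cases "\<bar>t\<bar> < \<delta>")
    case True
    have "0 \<le> D * t\<^sup>2" by (simp add: D_def)
    then show ?thesis using \<delta>(2)[OF True] by linarith
  next
    case False
    then have "\<delta>\<^sup>2 \<le> t\<^sup>2" using \<delta>(1) abs_le_square_iff[of \<delta> t] by simp
    then have "2 * norm a \<le> D * t\<^sup>2"
      using \<delta>(1) by (simp add: D_def field_simps mult_left_mono)
    moreover have "norm (\<alpha> t a - a) \<le> 2 * norm a"
      using norm_triangle_ineq4[of "\<alpha> t a" a] by (simp add: norm_dynamics)
    ultimately show ?thesis using e by simp
  qed
  define c where "c = 1 / sqrt (2 * pi * \<sigma>\<^sup>2)"
  define b where "b = integral UNIV (\<lambda>t. gaussian_kernel n t 0 *\<^sub>C \<alpha> t (c *\<^sub>R a))"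
  note ext = gaussian_smoothing_entire_extension[OF n(1), of "c *\<^sub>R a"]
  have "b \<in> analytic_elements algebra_structure \<alpha>"
    using ext unfolding b_def analytic_elements_def by blast
  moreover have "norm (b - a) < e"
  proof -
    have eq: "gaussian_kernel n t 0 *\<^sub>C \<alpha> t (c *\<^sub>R a) = ?w t *\<^sub>R \<alpha> t a" for t
    proof -
      have "?w t = exp (- n * t\<^sup>2) * c"
        by (simp add: normal_density_def c_def \<sigma>(2))
      then have "of_real (?w t) = gaussian_kernel n t 0 * of_real c"
        by (simp add: gaussian_kernel_def flip: exp_of_real)
      then show ?thesis
        by (simp add: scaleR_scaleC star_automorphism_scaleC[OF automorphism_dynamics] scaleC_scaleC)
    qed
    have "(\<lambda>t. gaussian_kernel n t 0 *\<^sub>C \<alpha> t (c *\<^sub>R a)) integrable_on UNIV"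
      by (rule gaussian_transform_entire(1)[OF n(1) strongly_continuous eq_refl[OF norm_dynamics]])
    then have "((\<lambda>t. ?w t *\<^sub>R \<alpha> t a) has_integral b) UNIV"
      unfolding b_def eq by (rule integrable_integral)
    from has_integral_diff[OF this has_integral_scaleR_left[OF w0, of a]]
    have d: "((\<lambda>t. ?w t *\<^sub>R (\<alpha> t a - a)) has_integral (b - a)) UNIV"
      by (simp add: scaleR_diff_right)
    have "((\<lambda>t. (e/2) * ?w t + D * (?w t * t\<^sup>2)) has_integral ((e/2) * 1 + D * \<sigma>\<^sup>2)) UNIV"
      by (intro has_integral_add has_integral_mult_right w0 w2)
    then have u: "((\<lambda>t. ?w t * (e/2 + D * t\<^sup>2)) has_integral (e/2 + D * \<sigma>\<^sup>2)) UNIV"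
      by (simp add: algebra_simps)
    have "norm (b - a) \<le> e/2 + D * \<sigma>\<^sup>2"
      using integral_norm_bound_integral[OF has_integral_integrable[OF d] has_integral_integrable[OF u]]
        close integral_unique[OF d] integral_unique[OF u]
      by (simp add: mult_left_mono)
    also have "\<dots> < e" using n e by (simp add: \<sigma>(2) field_simps)
    finally show ?thesis .
  qed
  ultimately show ?thesis by (rule that)
qed

lemma analytic_elements_determine:
  fixes \<phi> \<psi> :: "'a \<Rightarrow> complex"
  assumes "\<And>x y. \<phi> (x - y) = \<phi> x - \<phi> y" "\<And>x. cmod (\<phi> x) \<le> K * norm x"
    and "\<And>x. x \<in> analytic_elements algebra_structure \<alpha> \<Longrightarrow> \<phi> x = 0"
  shows "\<phi> a = 0"
proof (rule ccontr)
  assume "\<phi> a \<noteq> 0"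
  then have p: "0 < cmod (\<phi> a)" by simp
  then have K: "0 < K" using assms(2)[of a] by (metis mult_le_0_iff norm_ge_zero not_le order_less_le_trans)
  obtain b where b: "b \<in> analytic_elements algebra_structure \<alpha>" "norm (b - a) < cmod (\<phi> a) / K"
    using analytic_elements_dense[of "cmod (\<phi> a) / K" a] p K by auto
  have "cmod (\<phi> a) = cmod (\<phi> (b - a))" by (simp add: assms(1) assms(3)[OF b(1)])
  also have "\<dots> \<le> K * norm (b - a)" by (rule assms(2))
  also have "\<dots> < cmod (\<phi> a)" using b(2) K by (simp add: field_simps)
  finally show False by simp
qed

end

section \<open>Positive functionals\<close>

locale positive_form =
  fixes B :: "'v::complex_vector \<Rightarrow> 'v \<Rightarrow> complex"
  assumes add_left: "B (x + y) z = B x z + B y z" and add_right: "B z (x + y) = B z x + B z y"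
    and scale_left: "B (c *\<^sub>C x) y = cnj c * B x y" and scale_right: "B x (c *\<^sub>C y) = c * B x y"
    and positive: "0 \<le> B x x"
begin

lemma expand: "B (x + c *\<^sub>C y) (x + c *\<^sub>C y) = B x x + c * B x y + cnj c * B y x + cnj c * c * B y y"
  by (simp add: add_left add_right scale_left scale_right algebra_simps)

lemma Im_diagonal: "Im (B x x) = 0" and Re_diagonal: "0 \<le> Re (B x x)"
  using positive[of x] by (simp_all add: less_eq_complex_def)

lemma hermitian: "B y x = cnj (B x y)"
proof -
  have "Im (B x y) + Im (B y x) = 0"
    using Im_diagonal[of "x + 1 *\<^sub>C y"] Im_diagonal[of x] Im_diagonal[of y] unfolding expand by simp
  moreover have "Re (B x y) - Re (B y x) = 0"
    using Im_diagonal[of "x + \<i> *\<^sub>C y"] Im_diagonal[of x] Im_diagonal[of y] unfolding expand by simp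
  ultimately show ?thesis by (simp add: complex_eq_iff)
qed

lemma Cauchy_Schwarz: "(cmod (B x y))\<^sup>2 \<le> Re (B x x) * Re (B y y)"
proof -
  define m where "m = B x y"
  have quad: "0 \<le> Re (B x x) + 2 * r * (cmod m)\<^sup>2 + r\<^sup>2 * (cmod m)\<^sup>2 * Re (B y y)" for r
  proof -
    have "0 \<le> Re (B x x + (r * cnj m) * m + cnj (r * cnj m) * cnj m + cnj (r * cnj m) * (r * cnj m) * B y y)"
      using Re_diagonal[of "x + (r * cnj m) *\<^sub>C y"] unfolding expand hermitian[of y x] m_def .
    also have "\<dots> = Re (B x x) + 2 * r * (cmod m)\<^sup>2 + r\<^sup>2 * (cmod m)\<^sup>2 * Re (B y y)"
      unfolding cmod_power2 by (simp add: Im_diagonal algebra_simps power2_eq_square)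
    finally show ?thesis .
  qed
  show ?thesis unfolding m_def[symmetric]
  proof (cases "Re (B y y) = 0")
    case True
    have "m = 0"
    proof (rule ccontr)
      assume "m \<noteq> 0"
      then show False
        \<comment> \<open>The quadratic is then affine in \<open>r\<close>; at this \<open>r\<close> its value is \<open>- 1\<close>.\<close>
        using quad[of "- (Re (B x x) + 1) / (2 * (cmod m)\<^sup>2)"] True by (simp add: field_simps)
    qed
    then show "(cmod m)\<^sup>2 \<le> Re (B x x) * Re (B y y)" by (simp add: True)
  next
    case False
    then have p: "0 < Re (B y y)" using Re_diagonal[of y] by simp
    have "0 \<le> Re (B x x) - (cmod m)\<^sup>2 / Re (B y y)"
      \<comment> \<open>The minimum of the quadratic.\<close>
      using quad[of "- 1 / Re (B y y)"] p by (simp add: field_simps power2_eq_square)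
    then show "(cmod m)\<^sup>2 \<le> Re (B x x) * Re (B y y)" using p by (simp add: field_simps)
  qed
qed

end

lemma positive_form_algebra:
  assumes "clinear_functional \<omega>" and "\<And>a. 0 \<le> \<omega> (star a * a)"
  shows "positive_form (\<lambda>x y::'a::cstar_algebra. \<omega> (star x * y))"
  using assms
  by unfold_locales
    (simp_all add: clinear_functional_iff star_simps distrib_left distrib_right mult_scaleC_left
      mult_scaleC_right)

lemma statesD:
  assumes "\<omega> \<in> states algebra_structure"
  shows "clinear_functional \<omega>" "0 \<le> \<omega> (star a * a)" "\<omega> 1 = 1"
  using assms by (simp_all add: states_def algebra_structure_def)

lemma clinear_functionalD:
  assumes "clinear_functional \<omega>"
  shows "\<omega> (x + y) = \<omega> x + \<omega> y" "\<omega> (c *\<^sub>C x) = c * \<omega> x" "\<omega> 0 = 0" "\<omega> (x - y) = \<omega> x - \<omega> y"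
proof -
  have *: "\<omega> (x + y) = \<omega> x + \<omega> y" "\<omega> (c *\<^sub>C x) = c * \<omega> x" for x y c
    using assms by (simp_all add: clinear_functional_iff)
  show "\<omega> (x + y) = \<omega> x + \<omega> y" "\<omega> (c *\<^sub>C x) = c * \<omega> x" by (rule *)+
  show "\<omega> 0 = 0" using *(1)[of 0 0] by simp
  show "\<omega> (x - y) = \<omega> x - \<omega> y" using *(1)[of "x - y" y] by simp
qed

text \<open>
  For \<open>x = a\<^sup>*a / \<parallel>a\<parallel>\<^sup>2\<close> the element \<open>1 - x\<close> is a square, hence has nonnegative value.
\<close>

lemma state_star_mult_self_le:
  assumes w: "\<omega> \<in> states algebra_structure"
  shows "Re (\<omega> (star a * a)) \<le> (norm a)\<^sup>2"
proof (cases "a = 0")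
  case False
  note s = statesD[OF w] and l = clinear_functionalD[OF statesD(1)[OF w]]
  define x where "x = (1 / (norm a)\<^sup>2) *\<^sub>R (star a * a)"
  have "norm x \<le> 1" using False by (simp add: x_def cstar_identity)
  moreover have "star x = x" by (simp add: x_def star_simps)
  ultimately obtain y where y: "y * y = 1 - x" "star y = y" using exists_sqrt[of x] by metis
  have "0 \<le> Re (\<omega> (1 - x))"
    using s(2)[of y] by (simp add: y less_eq_complex_def)
  then have "0 \<le> 1 - Re (\<omega> (star a * a)) / (norm a)\<^sup>2"
    by (simp add: l s(3) x_def scaleR_scaleC flip: of_real_power)
  then show ?thesis using False by (simp add: field_simps)
qed (use clinear_functionalD[OF statesD(1)[OF w]] in simp)

lemma dominated_bound:
  assumes w: "\<omega> \<in> states algebra_structure" and d: "dominated_by \<rho> \<omega>"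
  shows "cmod (\<rho> a) \<le> norm a"
proof -
  have "complex_of_real ((cmod (\<rho> (star 1 * a)))\<^sup>2) \<le> \<omega> (star 1 * 1) * \<omega> (star a * a)"
    using d unfolding dominated_by_def by blast
  then have "(cmod (\<rho> a))\<^sup>2 \<le> Re (\<omega> (star a * a))"
    using statesD(3)[OF w] by (simp add: less_eq_complex_def)
  also have "\<dots> \<le> (norm a)\<^sup>2" by (rule state_star_mult_self_le[OF w])
  finally show ?thesis by (rule power2_le_imp_le) simp
qed

lemma state_dominated_by_itself:
  assumes w: "\<omega> \<in> states algebra_structure"
  shows "dominated_by \<omega> \<omega>"
  unfolding dominated_by_def
proof (intro allI)
  fix a b
  interpret positive_form "\<lambda>x y. \<omega> (star x * y)"
    by (rule positive_form_algebra) (rule statesD[OF w])+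
  show "complex_of_real ((cmod (\<omega> (star a * b)))\<^sup>2) \<le> \<omega> (star a * a) * \<omega> (star b * b)"
    using Cauchy_Schwarz[of a b] by (simp add: less_eq_complex_def Im_diagonal)
qed

context graded_cstar_dynamical_system
begin

lemmas grading_rules = star_automorphism_rules[OF automorphism_grading]

text \<open>
  Domination by a state makes \<open>\<phi>\<close> continuous, so invariance on the analytic elements suffices.
\<close>

lemma dominated_grading_invariant:
  fixes \<phi> :: "'a \<Rightarrow> complex"
  assumes w: "\<omega> \<in> states algebra_structure" and d: "dominated_by \<phi> \<omega>" and l: "clinear_functional \<phi>"
    and inv: "\<And>a. a \<in> analytic_elements algebra_structure \<alpha> \<Longrightarrow> \<phi> (\<gamma> a) = \<phi> a"
  shows "\<phi> (\<gamma> a) = \<phi> a"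
proof -
  note bl = star_automorphism_bounded_linear[OF automorphism_grading]
  have "\<phi> (\<gamma> a) - \<phi> a = 0"
  proof (rule analytic_elements_determine[where K=2])
    show "cmod (\<phi> (\<gamma> x) - \<phi> x) \<le> 2 * norm x" for x
      using norm_triangle_ineq4[of "\<phi> (\<gamma> x)" "\<phi> x"] dominated_bound[OF w d, of x]
        dominated_bound[OF w d, of "\<gamma> x"] by (simp add: star_automorphism_norm[OF automorphism_grading])
  qed (simp_all add: inv linear_diff[OF bounded_linear.linear[OF bl]] clinear_functionalD[OF l])
  then show ?thesis by simp
qed

text \<open>
  For analytic \<open>a\<close> this is the twisted KMS condition with \<open>b = 1\<close>, as the unit is fixed by the
  dynamics.
\<close>

lemma twisted_KMS_grading_invariant:
  assumes w: "\<omega> \<in> states algebra_structure" and d: "dominated_by \<rho> \<omega>"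
    and \<rho>: "\<rho> \<in> twisted_KMS_functionals \<alpha> \<gamma> \<beta>"
  shows "\<rho> (\<gamma> a) = \<rho> a"
proof (rule dominated_grading_invariant[OF w d])
  show "clinear_functional \<rho>" using \<rho> by (simp add: twisted_KMS_functionals_def)
  fix a assume "a \<in> analytic_elements algebra_structure \<alpha>"
  then have "\<rho> (a * complex_dynamics algebra_structure \<alpha> (\<i> * complex_of_real \<beta>) 1) = \<rho> (1 * \<gamma> a)"
    using \<rho> one_analytic unfolding twisted_KMS_functionals_def by blast
  then show "\<rho> (\<gamma> a) = \<rho> a" by (simp add: complex_dynamics_one)
qed

section \<open>KMS states of the crossed product\<close>

lemma crossed_simps:
  "Mult (crossed_product \<gamma>) (a, b) (c, d) = (a * c + b * \<gamma> d, a * d + b * \<gamma> c)"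
  "Star (crossed_product \<gamma>) (a, b) = (star a, \<gamma> (star b))"
  "Unit (crossed_product \<gamma>) = (1, 0)"
  by (simp_all add: crossed_product_def)

lemma KMS_states_crossed_iff:
  "W \<in> KMS_states (crossed_product \<gamma>) (crossed_dynamics \<alpha>) \<beta> \<longleftrightarrow>
    clinear_functional W \<and>
    (\<forall>a b. 0 \<le> W (star a * a + \<gamma> (star b) * \<gamma> b, star a * b + \<gamma> (star b) * \<gamma> a)) \<and> W (1, 0) = 1 \<and>
    (\<forall>a \<in> analytic_elements algebra_structure \<alpha>. \<forall>b \<in> analytic_elements algebra_structure \<alpha>.
     \<forall>c \<in> analytic_elements algebra_structure \<alpha>. \<forall>d \<in> analytic_elements algebra_structure \<alpha>.
      W (a * complex_dynamics algebra_structure \<alpha> (\<i> * complex_of_real \<beta>) c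
          + b * \<gamma> (complex_dynamics algebra_structure \<alpha> (\<i> * complex_of_real \<beta>) d),
         a * complex_dynamics algebra_structure \<alpha> (\<i> * complex_of_real \<beta>) d
          + b * \<gamma> (complex_dynamics algebra_structure \<alpha> (\<i> * complex_of_real \<beta>) c))
      = W (c * a + d * \<gamma> b, c * b + d * \<gamma> a))"
  unfolding KMS_states_def states_def
  by (auto simp: crossed_simps analytic_elements_crossed[OF automorphism_grading] Ball_def
      complex_dynamics_crossed[OF automorphism_grading])

lemma positive_form_crossed:
  assumes l: "clinear_functional W"
    and pos: "\<And>a b. 0 \<le> W (star a * a + \<gamma> (star b) * \<gamma> b, star a * b + \<gamma> (star b) * \<gamma> a)"
  shows "positive_form (\<lambda>x y. W (Mult (crossed_product \<gamma>) (Star (crossed_product \<gamma>) x) y))"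
proof
  note simps = crossed_simps clinear_functionalD[OF l, symmetric] star_simps grading_rules
    scaleC_prod_def mult_scaleC_left mult_scaleC_right scaleC_add_right
  fix x y z :: "'a \<times> 'a" and c :: complex
  show "W (Mult (crossed_product \<gamma>) (Star (crossed_product \<gamma>) (x + y)) z)
      = W (Mult (crossed_product \<gamma>) (Star (crossed_product \<gamma>) x) z)
        + W (Mult (crossed_product \<gamma>) (Star (crossed_product \<gamma>) y) z)"
    by (cases x; cases y; cases z) (simp add: simps algebra_simps)
  show "W (Mult (crossed_product \<gamma>) (Star (crossed_product \<gamma>) z) (x + y))
      = W (Mult (crossed_product \<gamma>) (Star (crossed_product \<gamma>) z) x)
        + W (Mult (crossed_product \<gamma>) (Star (crossed_product \<gamma>) z) y)"
    by (cases x; cases y; cases z) (simp add: simps algebra_simps)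
  show "W (Mult (crossed_product \<gamma>) (Star (crossed_product \<gamma>) (c *\<^sub>C x)) y)
      = cnj c * W (Mult (crossed_product \<gamma>) (Star (crossed_product \<gamma>) x) y)"
    by (cases x; cases y) (simp add: simps)
  show "W (Mult (crossed_product \<gamma>) (Star (crossed_product \<gamma>) x) (c *\<^sub>C y))
      = c * W (Mult (crossed_product \<gamma>) (Star (crossed_product \<gamma>) x) y)"
    by (cases x; cases y) (simp add: simps)
  show "0 \<le> W (Mult (crossed_product \<gamma>) (Star (crossed_product \<gamma>) x) x)"
    by (cases x) (simp add: crossed_simps pos)
qed

text \<open>
  The KMS conditions, positivity and domination come from elements with one zero component; the
  invariance of \<open>\<omega>\<close> comes from \<open>(0, a)\<close> and \<open>(0, 1)\<close>. The involution of the crossed product gives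
  only \<open>\<rho>(a) = cnj (\<rho>(\<gamma>(a\<^sup>*)))\<close>, so the hermitian property is proved last: removing \<open>\<gamma>\<close> requires the
  invariance of \<open>\<rho>\<close>, which rests on domination and the twisted KMS condition.
\<close>

lemma KMS_state_restriction:
  assumes W: "W \<in> KMS_states (crossed_product \<gamma>) (crossed_dynamics \<alpha>) \<beta>"
  defines "\<omega> \<equiv> \<lambda>a. W (a, 0)" and "\<rho> \<equiv> \<lambda>b. W (0, b)"
  shows "\<omega> \<in> invariant_KMS_states \<alpha> \<gamma> \<beta>"
    and "\<rho> \<in> dominated_twisted_KMS_functionals \<alpha> \<gamma> \<beta> \<omega>"
proof -
  let ?A = "analytic_elements algebra_structure \<alpha>"
  let ?d = "complex_dynamics algebra_structure \<alpha> (\<i> * complex_of_real \<beta>)"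
  note rules = W[unfolded KMS_states_crossed_iff]
  have l: "clinear_functional W" using rules by blast
  have pos: "0 \<le> W (star a * a + \<gamma> (star b) * \<gamma> b, star a * b + \<gamma> (star b) * \<gamma> a)" for a b
    using rules by blast
  have kms: "W (a * ?d c + b * \<gamma> (?d d), a * ?d d + b * \<gamma> (?d c)) = W (c * a + d * \<gamma> b, c * b + d * \<gamma> a)"
    if "a \<in> ?A" "b \<in> ?A" "c \<in> ?A" "d \<in> ?A" for a b c d
    using rules that by blast
  interpret positive_form "\<lambda>x y. W (Mult (crossed_product \<gamma>) (Star (crossed_product \<gamma>) x) y)"
    by (rule positive_form_crossed[OF l pos])
  have \<gamma>0: "\<gamma> 0 = 0" using grading_rules(1)[of 0 0] by simp
  have l\<omega>: "clinear_functional \<omega>" and l\<rho>: "clinear_functional \<rho>"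
    unfolding clinear_functional_iff \<omega>_def \<rho>_def
    by (simp_all add: clinear_functionalD[OF l, symmetric] scaleC_prod_def)
  have w: "\<omega> \<in> states algebra_structure"
    using pos[of _ 0] rules l\<omega> by (simp add: states_def algebra_structure_def \<omega>_def \<gamma>0)
  have "\<omega> (a * ?d c) = \<omega> (c * a)" if "a \<in> ?A" "c \<in> ?A" for a c
    using kms[of a 0 c 0] that zero_analytic by (simp add: \<omega>_def complex_dynamics_zero \<gamma>0)
  then have \<omega>: "\<omega> \<in> KMS_states algebra_structure \<alpha> \<beta>"
    using w by (simp add: KMS_states_def) (simp add: algebra_structure_def)
  have \<omega>\<gamma>: "\<omega> (\<gamma> a) = \<omega> a" for a
  proof (rule dominated_grading_invariant[OF w state_dominated_by_itself[OF w] l\<omega>])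
    fix a assume "a \<in> ?A"
    then show "\<omega> (\<gamma> a) = \<omega> a"
      using kms[of 0 a 0 1] zero_analytic one_analytic
      by (simp add: \<omega>_def complex_dynamics_zero complex_dynamics_one \<gamma>0 grading_rules)
  qed
  show "\<omega> \<in> invariant_KMS_states \<alpha> \<gamma> \<beta>" using \<omega> \<omega>\<gamma> by (simp add: invariant_KMS_states_def)
  have dom: "dominated_by \<rho> \<omega>"
    unfolding dominated_by_def
  proof (intro allI)
    fix a b
    have "(cmod (\<rho> (star a * b)))\<^sup>2 \<le> Re (\<omega> (star a * a)) * Re (\<omega> (star b * b))"
      using Cauchy_Schwarz[of "(a, 0)" "(0, b)"] \<omega>\<gamma>[of "star b * b"]
      by (simp add: crossed_simps \<gamma>0 \<omega>_def \<rho>_def grading_rules grading_grading)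
    then show "complex_of_real ((cmod (\<rho> (star a * b)))\<^sup>2) \<le> \<omega> (star a * a) * \<omega> (star b * b)"
      using statesD(2)[OF w] by (simp add: less_eq_complex_def)
  qed
  have "\<rho> (a * ?d b) = \<rho> (b * \<gamma> a)" if "a \<in> ?A" "b \<in> ?A" for a b
    using kms[of a 0 0 b] that zero_analytic by (simp add: \<rho>_def complex_dynamics_zero \<gamma>0)
  then have \<rho>: "\<rho> \<in> twisted_KMS_functionals \<alpha> \<gamma> \<beta>" using l\<rho> by (simp add: twisted_KMS_functionals_def)
  have "cnj (\<rho> (star a)) = \<rho> a" for a
  proof -
    have "\<rho> a = cnj (\<rho> (\<gamma> (star a)))"
      using hermitian[of "(0, a)" "(1, 0)"]
      by (simp add: crossed_simps \<gamma>0 \<rho>_def grading_rules)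
    then show ?thesis using twisted_KMS_grading_invariant[OF w dom \<rho>] by simp
  qed
  then show "\<rho> \<in> dominated_twisted_KMS_functionals \<alpha> \<gamma> \<beta> \<omega>"
    using \<rho> dom by (simp add: dominated_twisted_KMS_functionals_def hermitian_functional_def)
qed

text \<open>
  Positivity is \<open>p + q + 2 Re m \<ge> 0\<close> for \<open>p = \<omega>(a\<^sup>*a)\<close>, \<open>q = \<omega>(b\<^sup>*b)\<close> and \<open>m = \<rho>(a\<^sup>*b)\<close>, which follows from
  \<open>|m|\<^sup>2 \<le> p q\<close>. In the KMS condition the terms of the form \<open>b \<gamma>(d)\<close> are moved to \<open>\<gamma>(b) d\<close> by
  invariance, and \<open>\<gamma>\<close> commutes with the complexified dynamics.
\<close>

lemma KMS_state_of_pair: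
  assumes \<omega>: "\<omega> \<in> invariant_KMS_states \<alpha> \<gamma> \<beta>"
    and \<rho>: "\<rho> \<in> dominated_twisted_KMS_functionals \<alpha> \<gamma> \<beta> \<omega>"
  shows "(\<lambda>(a, b). \<omega> a + \<rho> b) \<in> KMS_states (crossed_product \<gamma>) (crossed_dynamics \<alpha>) \<beta>"
proof -
  let ?A = "analytic_elements algebra_structure \<alpha>"
  let ?d = "complex_dynamics algebra_structure \<alpha> (\<i> * complex_of_real \<beta>)"
  have w: "\<omega> \<in> states algebra_structure" and \<omega>\<gamma>: "\<And>a. \<omega> (\<gamma> a) = \<omega> a"
    and kms\<omega>: "\<And>a c. a \<in> ?A \<Longrightarrow> c \<in> ?A \<Longrightarrow> \<omega> (a * ?d c) = \<omega> (c * a)"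
    using \<omega> by (simp_all add: invariant_KMS_states_def KMS_states_def algebra_structure_def)
  have t: "\<rho> \<in> twisted_KMS_functionals \<alpha> \<gamma> \<beta>" and herm: "\<And>a. cnj (\<rho> (star a)) = \<rho> a"
    and dom: "dominated_by \<rho> \<omega>"
    using \<rho> by (simp_all add: dominated_twisted_KMS_functionals_def hermitian_functional_def)
  have kms\<rho>: "\<And>a b. a \<in> ?A \<Longrightarrow> b \<in> ?A \<Longrightarrow> \<rho> (a * ?d b) = \<rho> (b * \<gamma> a)" and l\<rho>: "clinear_functional \<rho>"
    using t by (simp_all add: twisted_KMS_functionals_def)
  note \<rho>\<gamma> = twisted_KMS_grading_invariant[OF w dom t]
  note L = clinear_functionalD[OF statesD(1)[OF w]] clinear_functionalD[OF l\<rho>]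
  have lin: "clinear_functional (\<lambda>(a, b). \<omega> a + \<rho> b)"
    by (auto simp: clinear_functional_iff L scaleC_prod_def algebra_simps)
  have unit: "\<omega> 1 + \<rho> 0 = 1" by (simp add: statesD[OF w] L)
  have pos: "0 \<le> \<omega> (star a * a + \<gamma> (star b) * \<gamma> b) + \<rho> (star a * b + \<gamma> (star b) * \<gamma> a)" for a b
  proof -
    define p q m where "p = Re (\<omega> (star a * a))" and "q = Re (\<omega> (star b * b))" and "m = \<rho> (star a * b)"
    have pq: "0 \<le> p" "0 \<le> q" "\<omega> (star a * a) = of_real p" "\<omega> (star b * b) = of_real q"
      using statesD(2)[OF w] by (simp_all add: p_def q_def less_eq_complex_def complex_eq_iff)
    have "\<rho> (star b * a) = cnj m"
      using herm[of "star b * a"] by (simp add: m_def star_simps)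
    then have "\<omega> (star a * a + \<gamma> (star b) * \<gamma> b) + \<rho> (star a * b + \<gamma> (star b) * \<gamma> a)
        = of_real (p + q) + (m + cnj m)"
      using \<omega>\<gamma>[of "star b * b"] \<rho>\<gamma>[of "star b * a"] by (simp add: L grading_rules pq m_def)
    also have "\<dots> = of_real (p + q + 2 * Re m)" by (simp add: complex_add_cnj)
    finally have eq: "\<omega> (star a * a + \<gamma> (star b) * \<gamma> b) + \<rho> (star a * b + \<gamma> (star b) * \<gamma> a)
        = of_real (p + q + 2 * Re m)" .
    have "complex_of_real ((cmod m)\<^sup>2) \<le> of_real p * of_real q"
      using dom unfolding dominated_by_def m_def pq(3,4)[symmetric] by blast
    then have "(cmod m)\<^sup>2 \<le> p * q" by (simp add: less_eq_complex_def)
    also have "\<dots> \<le> ((p + q) / 2)\<^sup>2"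
      using zero_le_power2[of "p - q"] by (simp add: power2_eq_square field_simps)
    finally have "cmod m \<le> (p + q) / 2" by (rule power2_le_imp_le) (use pq in simp)
    moreover have "- cmod m \<le> Re m" using abs_Re_le_cmod[of m] by (simp add: abs_le_iff)
    ultimately have "0 \<le> p + q + 2 * Re m" by argo
    then show ?thesis unfolding eq by (simp add: less_eq_complex_def)
  qed
  have kms: "\<omega> (a * ?d c + b * \<gamma> (?d d)) + \<rho> (a * ?d d + b * \<gamma> (?d c))
      = \<omega> (c * a + d * \<gamma> b) + \<rho> (c * b + d * \<gamma> a)"
    if an: "a \<in> ?A" "b \<in> ?A" "c \<in> ?A" "d \<in> ?A" for a b c d
  proof -
    have "\<omega> (b * \<gamma> (?d d)) = \<omega> (d * \<gamma> b)"
      using \<omega>\<gamma>[of "\<gamma> b * ?d d"] kms\<omega>[of "\<gamma> b" d] an grading_analytic(1)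
      by (simp add: grading_rules grading_grading)
    moreover have "\<rho> (b * \<gamma> (?d c)) = \<rho> (c * b)"
      using \<rho>\<gamma>[of "\<gamma> b * ?d c"] kms\<rho>[of "\<gamma> b" c] an grading_analytic(1)
      by (simp add: grading_rules grading_grading)
    ultimately show ?thesis
      by (simp add: L kms\<omega> kms\<rho> an)
  qed
  show ?thesis
    unfolding KMS_states_crossed_iff prod.case using lin unit pos kms by blast
qed

end

theorem theorem2p7:
  fixes \<alpha> :: "real \<Rightarrow> 'a::cstar_algebra \<Rightarrow> 'a"
    and \<gamma> :: "'a \<Rightarrow> 'a"
    and \<beta> :: real
  assumes "graded_cstar_dynamical_system \<alpha> \<gamma>"
    and "\<beta> \<noteq> 0"
  shows "bij_betw restriction_pair
           (KMS_states (crossed_product \<gamma>) (crossed_dynamics \<alpha>) \<beta>)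
           {(\<omega>, \<rho>). \<omega> \<in> invariant_KMS_states \<alpha> \<gamma> \<beta> \<and>
                     \<rho> \<in> dominated_twisted_KMS_functionals \<alpha> \<gamma> \<beta> \<omega>} \<and>
         (\<forall>\<omega> \<in> invariant_KMS_states \<alpha> \<gamma> \<beta>. \<forall>\<rho> \<in> dominated_twisted_KMS_functionals \<alpha> \<gamma> \<beta> \<omega>.
           inv_into (KMS_states (crossed_product \<gamma>) (crossed_dynamics \<alpha>) \<beta>) restriction_pair (\<omega>, \<rho>)
             = (\<lambda>(a, b). \<omega> a + \<rho> b))"
proof -
  interpret graded_cstar_dynamical_system \<alpha> \<gamma> by (rule assms(1))
  let ?K = "KMS_states (crossed_product \<gamma>) (crossed_dynamics \<alpha>) \<beta>"
  let ?P = "{(\<omega>, \<rho>). \<omega> \<in> invariant_KMS_states \<alpha> \<gamma> \<beta> \<and>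
                     \<rho> \<in> dominated_twisted_KMS_functionals \<alpha> \<gamma> \<beta> \<omega>}"
  let ?F = "\<lambda>(\<omega>, \<rho>). \<lambda>(a, b). \<omega> a + \<rho> b :: complex"
  have FR: "?F (restriction_pair W) = W" if "W \<in> ?K" for W
  proof -
    have l: "clinear_functional W" using that by (simp add: KMS_states_crossed_iff)
    show ?thesis
      by (simp add: restriction_pair_def fun_eq_iff clinear_functionalD[OF l, symmetric])
  qed
  have RF: "restriction_pair (?F (\<omega>, \<rho>)) = (\<omega>, \<rho>)" if "(\<omega>, \<rho>) \<in> ?P" for \<omega> \<rho>
  proof -
    have "clinear_functional \<omega>" "clinear_functional \<rho>"
      using that by (simp_all add: invariant_KMS_states_def KMS_states_def states_def
          dominated_twisted_KMS_functionals_def twisted_KMS_functionals_def)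
    then show ?thesis by (simp add: restriction_pair_def clinear_functionalD)
  qed
  have bij: "bij_betw restriction_pair ?K ?P"
  proof (rule bij_betw_byWitness[where f'="?F"])
    show "restriction_pair ` ?K \<subseteq> ?P"
      using KMS_state_restriction by (auto simp: restriction_pair_def)
    show "?F ` ?P \<subseteq> ?K" using KMS_state_of_pair by auto
  qed (use FR RF in auto)
  moreover have "inv_into ?K restriction_pair (\<omega>, \<rho>) = (\<lambda>(a, b). \<omega> a + \<rho> b)"
    if "\<omega> \<in> invariant_KMS_states \<alpha> \<gamma> \<beta>" "\<rho> \<in> dominated_twisted_KMS_functionals \<alpha> \<gamma> \<beta> \<omega>" for \<omega> \<rho>
    using bij_betw_imp_inj_on[OF bij] KMS_state_of_pair[OF that] RF[of \<omega> \<rho>] that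
    by (intro inv_into_f_eq) auto
  ultimately show ?thesis by blast
qed

end
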